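(* Let $0<p,q\leq\infty$. Then the differential operator $D:\mathcal{F}_p^\psi\to\mathcal{F}_q^\psi$, $Df=f'$, is unbounded. The same conclusion holds when $D$ acts between the classical Fock spaces, that is, $D:\mathcal{F}_p\to\mathcal{F}_q$ is unbounded for all $0<p,q\leq\infty$.
   Context: Notation: $U\simeq V$ means that there is a constant $C>0$ with $C^{-1}V\le U\le CV$ throughout the set in question. $dm$ is Lebesgue area measure on $\mathbb{C}$. Standing assumptions on the weight: $\psi:[0,\infty)\to[0,\infty)$ is twice continuously differentiable and is extended to $\mathbb{C}$ by $\psi(z)=\psi(|z|)$. The Laplacian $\Delta\psi$ of the extended function is positive. There is a positive, radial, differentiable function $\tau$ on $\mathbb{C}$ (write $\tau(z)=\tau(|z|)$) with $\tau(z)\simeq 1$ for $0\le|z|<1$ and $\tau(z)\simeq(\Delta\psi(z))^{-1/2}$ for $|z|\ge1$, such that $\lim_{r\to\infty}\tau(r)=0$ and $\lim_{r\to\infty}\tau'(r)=0$. In addition, either there exists a constant $C>0$ such that $\tau(r)r^C$ is increasing for large $r$, or $\lim_{r\to\infty}\tau'(r)\log\frac1{\tau(r)}=0$. Spaces: for $0<p<\infty$, $\mathcal{F}_p^\psi$ is the space of entire functions $f$ with $\|f\|_{\mathcal{F}_p^\psi}^p=\int_{\mathbb{C}}|f(z)|^pe^{-p\psi(z)}\,dm(z)<\infty$; $\mathcal{F}_\infty^\psi$ is the space of entire functions $f$ with $\|f\|_{\mathcal{F}_\infty^\psi}=\sup_{z\in\mathbb{C}}|f(z)|e^{-\psi(z)}<\infty$.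 The classical Fock spaces $\mathcal{F}_p$, $0<p\le\infty$, are defined in the same way with $\psi(z)$ replaced by $|z|^2/2$: $\|f\|_{\mathcal{F}_p}^p=\int_{\mathbb{C}}|f(z)|^pe^{-\frac p2|z|^2}\,dm(z)$ for $p<\infty$ and $\|f\|_{\mathcal{F}_\infty}=\sup_{z\in\mathbb{C}}|f(z)|e^{-|z|^2/2}$. "Unbounded" means not bounded: there is no constant $C$ such that $f'$ lies in the target space and $\|f'\|\le C\|f\|$ for all $f$ in the source space. *)

theory Defs
  imports "HOL-Complex_Analysis.Complex_Analysis"
begin

definition radial_ext :: "(real \<Rightarrow> real) \<Rightarrow> complex \<Rightarrow> real" where
  "radial_ext h z = h (cmod z)"

definition laplacian :: "(complex \<Rightarrow> real) \<Rightarrow> complex \<Rightarrow> real" where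
  "laplacian u z =
     deriv (deriv (\<lambda>x. u (Complex x (Im z)))) (Re z) +
     deriv (deriv (\<lambda>y. u (Complex (Re z) y))) (Im z)"

definition comparable_on :: "'a set \<Rightarrow> ('a \<Rightarrow> real) \<Rightarrow> ('a \<Rightarrow> real) \<Rightarrow> bool" where
  "comparable_on S U V \<longleftrightarrow>
     (\<exists>C>0. \<forall>z\<in>S. inverse C * V z \<le> U z \<and> U z \<le> C * V z)"

text \<open>Derivatives at the endpoint 0 are one-sided.\<close>

definition C2_halfline :: "(real \<Rightarrow> real) \<Rightarrow> bool" where
  "C2_halfline \<psi> \<longleftrightarrow> (\<exists>\<psi>1 \<psi>2.
     (\<forall>r\<ge>0. (\<psi> has_real_derivative \<psi>1 r) (at r within {0..})) \<and>
     (\<forall>r\<ge>0. (\<psi>1 has_real_derivative \<psi>2 r) (at r within {0..})) \<and>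
     continuous_on {0..} \<psi>2)"

text \<open>The function \<open>\<tau>\<close> is given by its radial profile. Only values of \<open>\<psi>\<close> and \<open>\<tau>\<close> on
  the half-line \<open>{0..}\<close> matter.

  Positivity of the Laplacian is required off the origin, which is where the radial extension of a
  \<open>C\<^sup>2\<close> profile is automatically \<open>C\<^sup>2\<close>. At 0 the Laplacian need not exist, as for
  \<open>\<psi> r = exp (\<beta> * r)\<close>, and it may vanish, as for \<open>\<psi> r = r ^ 4\<close>. A weight whose Laplacian
  exists and is positive on the whole plane is a special case.\<close>

definition rapid_weight_with :: "(real \<Rightarrow> real) \<Rightarrow> (real \<Rightarrow> real) \<Rightarrow> bool" where
  "rapid_weight_with \<psi> \<tau> \<longleftrightarrow>
     (\<forall>r\<ge>0. 0 \<le> \<psi> r) \<and>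
     C2_halfline \<psi> \<and>
     (\<forall>z. z \<noteq> 0 \<longrightarrow> 0 < laplacian (radial_ext \<psi>) z) \<and>
     (\<forall>z. 0 < radial_ext \<tau> z) \<and>
     (\<forall>z. radial_ext \<tau> differentiable (at z)) \<and>
     comparable_on {z. cmod z < 1} (radial_ext \<tau>) (\<lambda>_. 1) \<and>
     comparable_on {z. 1 \<le> cmod z} (radial_ext \<tau>)
       (\<lambda>z. laplacian (radial_ext \<psi>) z powr (- 1 / 2)) \<and>
     (\<tau> \<longlongrightarrow> 0) at_top \<and>
     (deriv \<tau> \<longlongrightarrow> 0) at_top \<and>
     ((\<exists>C>0. \<exists>R. mono_on {R..} (\<lambda>r. \<tau> r * r powr C)) \<or>
      ((\<lambda>r. deriv \<tau> r * ln (1 / \<tau> r)) \<longlongrightarrow> 0) at_top)"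

definition rapid_weight :: "(real \<Rightarrow> real) \<Rightarrow> bool" where
  "rapid_weight \<psi> \<longleftrightarrow> (\<exists>\<tau>. rapid_weight_with \<psi> \<tau>)"

text \<open>The Fock space of exponent \<open>p\<close>, \<open>0 < p \<le> \<infinity>\<close>, for an arbitrary weight
  \<open>\<phi>\<close> on the plane. The value of \<open>fock_norm\<close> is meaningful only on \<open>fock_space\<close>.\<close>

definition fock_space :: "ennreal \<Rightarrow> (complex \<Rightarrow> real) \<Rightarrow> (complex \<Rightarrow> complex) set" where
  "fock_space p \<phi> = {f. f holomorphic_on UNIV \<and>
     (if p = \<infinity> then bdd_above (range (\<lambda>z. cmod (f z) * exp (- \<phi> z)))
      else integrable lborel
             (\<lambda>z. cmod (f z) powr enn2real p * exp (- enn2real p * \<phi> z)))}"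

definition fock_norm :: "ennreal \<Rightarrow> (complex \<Rightarrow> real) \<Rightarrow> (complex \<Rightarrow> complex) \<Rightarrow> real" where
  "fock_norm p \<phi> f =
     (if p = \<infinity> then (SUP z. cmod (f z) * exp (- \<phi> z))
      else (LINT z|lborel. cmod (f z) powr enn2real p * exp (- enn2real p * \<phi> z))
             powr (1 / enn2real p))"

definition fock_bounded ::
    "ennreal \<Rightarrow> ennreal \<Rightarrow> (complex \<Rightarrow> real)
      \<Rightarrow> ((complex \<Rightarrow> complex) \<Rightarrow> complex \<Rightarrow> complex) \<Rightarrow> bool" where
  "fock_bounded p q \<phi> T \<longleftrightarrow>
     (\<exists>C. \<forall>f\<in>fock_space p \<phi>.
        T f \<in> fock_space q \<phi> \<and> fock_norm q \<phi> (T f) \<le> C * fock_norm p \<phi> f)"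

definition classical_weight :: "complex \<Rightarrow> real" where
  "classical_weight z = (cmod z)\<^sup>2 / 2"

end

theory Submission
  imports Defs
begin

text \<open>
  In the variable \<open>x = ln |z|\<close> a radial weight \<open>\<phi>\<close> is convex, because
  \<open>\<phi>'' = |z|\<^sup>2 \<Delta>\<psi>\<close>; and \<open>\<tau> \<rightarrow> 0\<close> forces \<open>\<phi>'' \<ge> c |z|\<^sup>2\<close> near infinity, which also
  holds for the classical weight. Hence a monomial \<open>z ^ n\<close> times the weight is a log-concave peak
  \<open>exp (- B x)\<close>, \<open>B\<close> being the Bregman divergence of \<open>\<phi>\<close>, and convexity alone
  compares all its \<open>L\<^sup>p\<close> norms with its width. Differentiation multiplies the peak by
  \<open>n / r\<close>, which is at least a constant times \<open>r\<close>.

  It remains to find test functions \<open>f\<close> with \<open>|f| exp (- W)\<close> bounded and of size comparable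
  to 1 on a set of area \<open>A\<close> carrying all of its \<open>L\<^sup>p\<close> norm up to a constant:
  a small \<open>A\<close> refutes boundedness for \<open>p \<le> q\<close>, a large \<open>A\<close> for \<open>q \<le> p\<close>.
  For \<open>p \<le> q\<close> a monomial is localised in angle by the factor
  \<open>((z + r)\<^sup>2 / (4 r z)) ^ m\<close> with \<open>m\<close> of order \<open>r\<^sup>2\<close>. For \<open>q \<le> p\<close> one adds
  up monomials whose peaks are just far enough apart not to interfere and fill an annulus.
\<close>

section \<open>Integration in polar coordinates\<close>

text \<open>The argument runs on a lower bound for \<open>\<phi>''\<close> alone, so a peak may be
  very narrow and lopsided. Its width \<open>w\<close> is therefore read off from the two points
  where the divergence equals 1: convexity keeps it below 1 between them and makes it grow linearly
  outside. The lower bound for \<open>\<phi>''\<close> limits \<open>w\<close> to a constant over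
  \<open>r\<close>.

  This decides the test functions. A single monomial fills an area of order \<open>w r ^ 2\<close>,
  which need be neither bounded nor bounded away from 0. Cutting the angle down to order
  \<open>1 / r\<close> leaves \<open>w r\<close>, which is bounded. An annulus of logarithmic
  thickness between 1 and 2 has area of order \<open>r ^ 2\<close>. The area only has to stay on the
  right side of a constant; the blow-up comes from \<open>n / r\<close>.

  The order of \<open>m\<close> balances two demands. Off the radius \<open>r\<close> the angular
  factor can grow like \<open>exp (m * min (u ^ 2) \<bar>u\<bar>)\<close> with
  \<open>u = ln (|z| / r)\<close>, and the divergence, which is at least a constant times
  \<open>r ^ 2 * min (u ^ 2) \<bar>u\<bar>\<close>, must absorb this; on the other hand the angular
  width is \<open>1 / sqrt m\<close>.\<close>

lemma nn_integral_complex: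
  assumes [measurable]: "F \<in> borel_measurable borel"
  shows "(\<integral>\<^sup>+z. F z \<partial>lborel) = (\<integral>\<^sup>+x. \<integral>\<^sup>+y. F (Complex x y) \<partial>lborel \<partial>lborel)"
proof -
  have [measurable]: "(\<lambda>(x,y). Complex x y) \<in> borel_measurable (borel \<Otimes>\<^sub>M borel)"
    unfolding borel_prod Complex_eq case_prod_beta
    by (intro borel_measurable_continuous_onI continuous_intros)
  have eq: "(lborel :: complex measure) =
      distr (lborel \<Otimes>\<^sub>M lborel) borel (\<lambda>(x,y). Complex x y)"
  proof (rule lborel_eqI)
    fix l u :: complex
    assume le: "\<And>b. b \<in> Basis \<Longrightarrow> l \<bullet> b \<le> u \<bullet> b"
    have le': "Re l \<le> Re u" "Im l \<le> Im u"
      using le[of 1] le[of \<i>] by (auto simp: Basis_complex_def)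
    have "emeasure (distr (lborel \<Otimes>\<^sub>M lborel) borel (\<lambda>(x,y). Complex x y)) (box l u)
       = emeasure (lborel \<Otimes>\<^sub>M lborel) ({Re l<..<Re u} \<times> {Im l<..<Im u})"
      by (subst emeasure_distr)
         (auto simp: space_pair_measure box_def Basis_complex_def intro!: arg_cong2[where f=emeasure])
    also have "\<dots> = emeasure lborel {Re l<..<Re u} * emeasure lborel {Im l<..<Im u}"
      by (subst lborel.emeasure_pair_measure_Times) auto
    also have "\<dots> = ennreal (\<Prod>b\<in>Basis. (u - l) \<bullet> b)"
      using le' by (simp add: Basis_complex_def ennreal_mult')
    finally show "emeasure (distr (lborel \<Otimes>\<^sub>M lborel) borel (\<lambda>(x,y). Complex x y)) (box l u) =
      (\<Prod>b\<in>Basis. (u - l) \<bullet> b)" .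
  qed simp
  show ?thesis
    by (subst eq, subst nn_integral_distr)
       (auto simp: case_prod_beta' lborel.nn_integral_fst[symmetric] intro!: nn_integral_cong)
qed

text \<open>Polar coordinates with the slope \<open>t\<close> of the line through the origin in place of the angle,
  and a signed radius, so that only linear substitutions are needed.\<close>

lemma nn_integral_polar:
  assumes F[measurable]: "F \<in> borel_measurable borel"
  shows "(\<integral>\<^sup>+z. F z \<partial>lborel) = (\<integral>\<^sup>+t. \<integral>\<^sup>+\<rho>. ennreal (\<bar>\<rho>\<bar> / (1 + t\<^sup>2)) *
     F (Complex (\<rho> / sqrt (1 + t\<^sup>2)) (t * \<rho> / sqrt (1 + t\<^sup>2))) \<partial>lborel \<partial>lborel)"
proof -
  have [measurable]: "(\<lambda>(x,y). Complex x y) \<in> borel_measurable (borel \<Otimes>\<^sub>M borel)"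
    unfolding borel_prod Complex_eq case_prod_beta
    by (intro borel_measurable_continuous_onI continuous_intros)
  have [measurable]: "(\<lambda>w. Complex (f w) (g w)) \<in> borel_measurable M"
    if [measurable]: "f \<in> borel_measurable M" "g \<in> borel_measurable M"
    for f g :: "'a \<Rightarrow> real" and M
    using measurable_compose[OF _ \<open>(\<lambda>(x,y). Complex x y) \<in> borel_measurable (borel \<Otimes>\<^sub>M borel)\<close>,
      of "\<lambda>w. (f w, g w)" M] by simp
  have "(\<integral>\<^sup>+z. F z \<partial>lborel) = (\<integral>\<^sup>+x. \<integral>\<^sup>+y. F (Complex x y) \<partial>lborel \<partial>lborel)"
    by (rule nn_integral_complex) fact
  also have "\<dots> = (\<integral>\<^sup>+x. \<integral>\<^sup>+t. ennreal \<bar>x\<bar> * F (Complex x (x * t)) \<partial>lborel \<partial>lborel)"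
  proof (rule nn_integral_cong_AE, rule AE_mp[OF AE_lborel_singleton[of 0]], rule AE_I2, rule impI)
    fix x :: real assume "x \<noteq> 0"
    then show "(\<integral>\<^sup>+y. F (Complex x y) \<partial>lborel) = (\<integral>\<^sup>+t. ennreal \<bar>x\<bar> * F (Complex x (x * t)) \<partial>lborel)"
      by (subst nn_integral_real_affine[where c=x and t=0]) (auto simp: nn_integral_cmult)
  qed
  also have "\<dots> = (\<integral>\<^sup>+t. \<integral>\<^sup>+x. ennreal \<bar>x\<bar> * F (Complex x (x * t)) \<partial>lborel \<partial>lborel)"
    by (rule lborel_pair.Fubini') measurable
  also have "\<dots> = (\<integral>\<^sup>+t. \<integral>\<^sup>+\<rho>. ennreal (\<bar>\<rho>\<bar> / (1 + t\<^sup>2)) *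
     F (Complex (\<rho> / sqrt (1 + t\<^sup>2)) (t * \<rho> / sqrt (1 + t\<^sup>2))) \<partial>lborel \<partial>lborel)"
  proof (rule nn_integral_cong)
    fix t :: real
    \<comment> \<open>The cosine of the angle of the line with slope \<open>t\<close>; after
      \<open>x = s * \<rho>\<close> the variable \<open>\<rho>\<close> is the signed distance to the
      origin.\<close>
    define s where "s = 1 / sqrt (1 + t\<^sup>2)"
    have pos: "1 + t\<^sup>2 > 0" by (simp add: add_pos_nonneg)
    have s: "s > 0" "s * s = 1 / (1 + t\<^sup>2)"
      using pos by (auto simp: s_def)
    have "(\<integral>\<^sup>+x. ennreal \<bar>x\<bar> * F (Complex x (x * t)) \<partial>lborel)
       = ennreal \<bar>s\<bar> * (\<integral>\<^sup>+\<rho>. ennreal \<bar>0 + s * \<rho>\<bar> * F (Complex (0 + s * \<rho>) ((0 + s * \<rho>) * t)) \<partial>lborel)"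
      by (rule nn_integral_real_affine) (use s in auto)
    also have "\<dots> = (\<integral>\<^sup>+\<rho>. ennreal (s * s * \<bar>\<rho>\<bar>) * F (Complex (s * \<rho>) (s * \<rho> * t)) \<partial>lborel)"
      using s(1) by (subst nn_integral_cmult[symmetric])
        (auto simp: abs_mult ennreal_mult' mult.assoc intro!: nn_integral_cong)
    finally show "(\<integral>\<^sup>+x. ennreal \<bar>x\<bar> * F (Complex x (x * t)) \<partial>lborel) =
      (\<integral>\<^sup>+\<rho>. ennreal (\<bar>\<rho>\<bar> / (1 + t\<^sup>2)) *
        F (Complex (\<rho> / sqrt (1 + t\<^sup>2)) (t * \<rho> / sqrt (1 + t\<^sup>2))) \<partial>lborel)"
      unfolding s(2) by (simp add: s_def mult_ac)
  qed
  finally show ?thesis .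
qed

text \<open>The slope \<open>t\<close> is the tangent of the angle, so the second claim is the
  formula for the squared sine. It turns the angular decay of a test function into a function of
  \<open>t\<close> alone.\<close>

lemma polar_point:
  fixes \<rho> t :: real
  defines "z \<equiv> Complex (\<rho> / sqrt (1 + t\<^sup>2)) (t * \<rho> / sqrt (1 + t\<^sup>2))"
  shows "cmod z = \<bar>\<rho>\<bar>" and "\<rho> \<noteq> 0 \<Longrightarrow> (Im z / cmod z)\<^sup>2 = t\<^sup>2 / (1 + t\<^sup>2)"
proof -
  have pos: "1 + t\<^sup>2 > 0" using add_pos_nonneg[of 1 "t\<^sup>2"] by simp
  have "(\<rho> / sqrt (1 + t\<^sup>2))\<^sup>2 + (t * \<rho> / sqrt (1 + t\<^sup>2))\<^sup>2 = \<rho>\<^sup>2 * (1 + t\<^sup>2) / (1 + t\<^sup>2)"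
    by (simp add: power_divide power_mult_distrib add_divide_distrib algebra_simps)
  also have "\<dots> = \<rho>\<^sup>2" using pos by simp
  finally show c: "cmod z = \<bar>\<rho>\<bar>" by (simp add: cmod_def z_def)
  assume "\<rho> \<noteq> 0"
  then show "(Im z / cmod z)\<^sup>2 = t\<^sup>2 / (1 + t\<^sup>2)"
    unfolding c using pos by (simp add: z_def power_divide power_mult_distrib)
qed

lemma nn_integral_abs:
  fixes h :: "real \<Rightarrow> ennreal"
  assumes [measurable]: "h \<in> borel_measurable borel"
  shows "(\<integral>\<^sup>+\<rho>. h \<bar>\<rho>\<bar> \<partial>lborel) = 2 * (\<integral>\<^sup>+\<rho>. h \<rho> * indicator {0<..} \<rho> \<partial>lborel)"
proof -
  have "(\<integral>\<^sup>+\<rho>. h \<bar>\<rho>\<bar> \<partial>lborel) =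
     (\<integral>\<^sup>+\<rho>. h \<rho> * indicator {0<..} \<rho> + h (- \<rho>) * indicator {0<..} (- \<rho>) \<partial>lborel)"
    by (rule nn_integral_cong_AE, rule AE_mp[OF AE_lborel_singleton[of 0]], rule AE_I2)
       (auto simp: indicator_def)
  also have "\<dots> = (\<integral>\<^sup>+\<rho>. h \<rho> * indicator {0<..} \<rho> \<partial>lborel) +
      (\<integral>\<^sup>+\<rho>. h (- \<rho>) * indicator {0<..} (- \<rho>) \<partial>lborel)"
    by (rule nn_integral_add) measurable
  also have "(\<integral>\<^sup>+\<rho>. h (- \<rho>) * indicator {0<..} (- \<rho>) \<partial>lborel) =
      (\<integral>\<^sup>+\<rho>. h \<rho> * indicator {0<..} \<rho> \<partial>lborel)"
    using nn_integral_real_affine[of "\<lambda>\<rho>. h \<rho> * indicator {0<..} \<rho>" "-1" 0] by simp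
  finally show ?thesis by (simp add: mult_2)
qed

text \<open>For \<open>k = 1\<close> this is the angular integral of a radial function; the two
  signs of the radius complete the half circle of lines to a full circle. General \<open>k\<close>
  measures angular concentration, with gain \<open>1 / sqrt k\<close>.\<close>

lemma nn_integral_inverse_quadratic:
  fixes k :: real
  assumes "k > 0"
  shows "(\<integral>\<^sup>+t. ennreal (1 / (1 + k * t\<^sup>2)) \<partial>lborel) = ennreal (pi / sqrt k)"
proof -
  have k: "sqrt k > 0" using assms by simp
  define h where "h = (\<lambda>t. ennreal (1 / (1 + k * t\<^sup>2)))"
  have [measurable]: "h \<in> borel_measurable borel" unfolding h_def by measurable
  have "(\<integral>\<^sup>+t. h t * indicator {0..} t \<partial>lborel) = ennreal ((pi / 2) / sqrt k - arctan (sqrt k * 0) / sqrt k)"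
    unfolding h_def
  proof (rule nn_integral_FTC_atLeast)
    show "((\<lambda>t. arctan (sqrt k * t) / sqrt k) \<longlongrightarrow> pi / 2 / sqrt k) at_top"
      using k by (intro tendsto_intros filterlim_compose[OF tendsto_arctan_at_top]
        filterlim_tendsto_pos_mult_at_top[OF tendsto_const] filterlim_ident) auto
    fix x :: real
    show "((\<lambda>t. arctan (sqrt k * t) / sqrt k) has_real_derivative 1 / (1 + k * x\<^sup>2)) (at x)"
      using k assms by (auto intro!: derivative_eq_intros simp: power_mult_distrib divide_simps)
    show "0 \<le> 1 / (1 + k * x\<^sup>2)" using assms by simp
  qed simp
  also have "(\<integral>\<^sup>+t. h t * indicator {0..} t \<partial>lborel) = (\<integral>\<^sup>+t. h t * indicator {0<..} t \<partial>lborel)"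
    by (rule nn_integral_cong_AE, rule AE_mp[OF AE_lborel_singleton[of 0]], rule AE_I2)
       (auto simp: indicator_def)
  finally have "(\<integral>\<^sup>+t. h \<bar>t\<bar> \<partial>lborel) = ennreal 2 * ennreal (pi / 2 / sqrt k)"
    by (subst nn_integral_abs) auto
  also have "\<dots> = ennreal (pi / sqrt k)"
    by (subst ennreal_mult'[symmetric]) auto
  finally show ?thesis by (simp add: h_def)
qed

section \<open>The radial integral of a peak with linear tails\<close>

text \<open>The integrand has the shape that is left of a localised monomial after integration over
  the angle: half of the exponent has paid for the angular factor, and
  \<open>exp (\<bar>ln \<rho> - x0\<bar> / 2)\<close> is the loss of angular concentration away from
  the peak.\<close>

lemma nn_integral_peak_le:
  fixes B :: "real \<Rightarrow> real" and p w x0 :: real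
  assumes p: "p > 0" and w: "w > 0" "10 * w \<le> p"
    and B: "\<And>x. B x \<ge> \<bar>x - x0\<bar> / w - 1"
  shows "(\<integral>\<^sup>+\<rho>. ennreal (exp (- p * B (ln \<rho>) / 2 + \<bar>ln \<rho> - x0\<bar> / 2) * \<rho>) * indicator {0<..} \<rho> \<partial>lborel)
     \<le> ennreal (8 * exp (p / 2) / p * w * exp (2 * x0))"
proof -
  define \<alpha> where "\<alpha> = p / (4 * w)"
  define r where "r = exp x0"
  have r: "r > 0" "ln r = x0" by (simp_all add: r_def)
  have \<alpha>: "\<alpha> > 0" using p w by (simp add: \<alpha>_def)
  have \<alpha>2: "\<alpha> \<ge> 5 / 2" using w by (simp add: \<alpha>_def field_simps)
  \<comment> \<open>The rate available is \<open>2 * \<alpha> - 1 / 2\<close>; keeping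
    \<open>\<alpha> + 2\<close> of it takes \<open>\<alpha> \<ge> 5 / 2\<close>, which is where
    \<open>10 * w \<le> p\<close> comes from.\<close>
  have expo: "- p * B x / 2 + \<bar>x - x0\<bar> / 2 \<le> p / 2 - (\<alpha> + 2) * \<bar>x - x0\<bar>" for x
  proof -
    have "p * B x \<ge> p * (\<bar>x - x0\<bar> / w - 1)" using B[of x] p by (intro mult_left_mono) auto
    also have "p * (\<bar>x - x0\<bar> / w - 1) = 4 * \<alpha> * \<bar>x - x0\<bar> - p"
      using w by (simp add: \<alpha>_def field_simps)
    finally have 1: "p * B x / 2 \<ge> 2 * \<alpha> * \<bar>x - x0\<bar> - p / 2" by simp
    have "5 / 2 * \<bar>x - x0\<bar> \<le> \<alpha> * \<bar>x - x0\<bar>" using \<alpha>2 by (intro mult_right_mono) auto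
    with 1 show ?thesis by (simp add: algebra_simps)
  qed
  \<comment> \<open>Both majorants have elementary antiderivatives. Left of \<open>r\<close> the
    logarithmic distance is replaced by the smaller \<open>1 - \<rho> / r\<close>; right of
    \<open>r\<close> the spare rate 2 turns the factor \<open>\<rho>\<close> into
    \<open>r ^ 2 / \<rho>\<close>, which fits a derivative in \<open>ln \<rho>\<close>.\<close>
  have le: "exp (- p * B (ln \<rho>) / 2 + \<bar>ln \<rho> - x0\<bar> / 2) * \<rho> \<le>
      exp (p / 2) * (r * exp (- \<alpha> * (1 - \<rho> / r))) * indicator {0..r} \<rho> +
      exp (p / 2) * (r\<^sup>2 / \<rho> * exp (- \<alpha> * (ln \<rho> - x0))) * indicator {r..} \<rho>" (is "?L \<le> ?R")
    if \<rho>: "\<rho> > 0" for \<rho>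
  proof (cases "\<rho> \<le> r")
    case True
    have "ln (\<rho> / r) \<le> \<rho> / r - 1" using \<rho> r by (intro ln_le_minus_one) simp
    then have 1: "1 - \<rho> / r \<le> \<bar>ln \<rho> - x0\<bar>" using \<rho> r by (simp add: ln_div)
    have "?L \<le> exp (p / 2 + - \<alpha> * (1 - \<rho> / r)) * r"
    proof (rule mult_mono)
      have "\<alpha> * (1 - \<rho> / r) \<le> (\<alpha> + 2) * \<bar>ln \<rho> - x0\<bar>"
        using 1 \<alpha> True \<rho> r by (intro mult_mono) auto
      with expo[of "ln \<rho>"]
      show "exp (- p * B (ln \<rho>) / 2 + \<bar>ln \<rho> - x0\<bar> / 2) \<le> exp (p / 2 + - \<alpha> * (1 - \<rho> / r))"
        by (simp only: exp_le_cancel_iff)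
    qed (use True \<rho> r in auto)
    also have "\<dots> = exp (p / 2) * (r * exp (- \<alpha> * (1 - \<rho> / r)))"
      by (simp only: exp_add mult_ac)
    also have "\<dots> \<le> ?R" using True \<rho> by simp
    finally show ?thesis .
  next
    case False
    then have u: "ln \<rho> - x0 > 0" using \<rho> r by (metis diff_gt_0_iff_gt ln_less_cancel_iff not_le)
    have "?L \<le> exp (p / 2 - (\<alpha> + 2) * (ln \<rho> - x0)) * \<rho>"
      using expo[of "ln \<rho>"] \<rho> u by (intro mult_right_mono) auto
    also have "\<dots> = exp (p / 2) * (exp (- (2 * (ln \<rho> - x0))) * \<rho> * exp (- \<alpha> * (ln \<rho> - x0)))"
      by (simp add: exp_add[symmetric] exp_diff[symmetric] algebra_simps)
    also have "exp (- (2 * (ln \<rho> - x0))) * \<rho> = r\<^sup>2 / \<rho>"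
    proof -
      have "exp (- (2 * (ln \<rho> - x0))) = exp (2 * (x0 - ln \<rho>))" by simp
      also have "\<dots> = (r / \<rho>)\<^sup>2" using \<rho> by (simp only: exp_double exp_diff r_def exp_ln)
      finally show ?thesis using \<rho> by (simp add: power2_eq_square)
    qed
    finally show ?thesis using False \<rho> by simp
  qed
  have I1: "(\<integral>\<^sup>+\<rho>. ennreal (exp (p / 2) * (r * exp (- \<alpha> * (1 - \<rho> / r)))) * indicator {0..r} \<rho> \<partial>lborel)
      = ennreal (exp (p / 2) * (r\<^sup>2 / \<alpha> * exp (- \<alpha> * (1 - r / r))) - exp (p / 2) * (r\<^sup>2 / \<alpha> * exp (- \<alpha> * (1 - 0 / r))))"
    by (rule nn_integral_FTC_Icc[where
      F = "\<lambda>\<rho>. exp (p / 2) * (r\<^sup>2 / \<alpha> * exp (- \<alpha> * (1 - \<rho> / r)))"])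
       (use r \<alpha> in \<open>auto intro!: derivative_eq_intros simp: field_simps power2_eq_square simp flip: has_real_derivative_iff_has_vector_derivative\<close>)
  have I2: "(\<integral>\<^sup>+\<rho>. ennreal (exp (p / 2) * (r\<^sup>2 / \<rho> * exp (- \<alpha> * (ln \<rho> - x0)))) * indicator {r..} \<rho> \<partial>lborel)
      = ennreal (0 - (- exp (p / 2) * (r\<^sup>2 / \<alpha> * exp (- \<alpha> * (ln r - x0)))))"
  proof (rule nn_integral_FTC_atLeast[where
      F = "\<lambda>\<rho>. - exp (p / 2) * (r\<^sup>2 / \<alpha> * exp (- \<alpha> * (ln \<rho> - x0)))"])
    fix x assume "r \<le> x"
    then have x: "x > 0" using r by simp
    show "((\<lambda>\<rho>. - exp (p / 2) * (r\<^sup>2 / \<alpha> * exp (- \<alpha> * (ln \<rho> - x0)))) has_real_derivative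
      exp (p / 2) * (r\<^sup>2 / x * exp (- \<alpha> * (ln x - x0)))) (at x)"
      using x \<alpha> by (auto intro!: derivative_eq_intros simp: field_simps)
    show "0 \<le> exp (p / 2) * (r\<^sup>2 / x * exp (- \<alpha> * (ln x - x0)))" using x by simp
  next
    have "LIM \<rho> at_top. \<alpha> * (- x0 + ln \<rho>) :> at_top"
      using \<alpha> by (intro filterlim_tendsto_pos_mult_at_top[OF tendsto_const]
        filterlim_tendsto_add_at_top[OF tendsto_const] ln_at_top) auto
    then have "((\<lambda>\<rho>. exp (- (\<alpha> * (- x0 + ln \<rho>)))) \<longlongrightarrow> 0) at_top"
      by (intro filterlim_compose[OF exp_at_bot] filterlim_compose[OF filterlim_uminus_at_bot_at_top])
    then have "((\<lambda>\<rho>. - exp (p / 2) * (r\<^sup>2 / \<alpha> * exp (- (\<alpha> * (- x0 + ln \<rho>))))) \<longlongrightarrow> - exp (p / 2) * (r\<^sup>2 / \<alpha> * 0)) at_top"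
      by (intro tendsto_intros)
    then show "((\<lambda>\<rho>. - exp (p / 2) * (r\<^sup>2 / \<alpha> * exp (- \<alpha> * (ln \<rho> - x0)))) \<longlongrightarrow> 0) at_top"
      by simp
  qed simp
  have "(\<integral>\<^sup>+\<rho>. ennreal (exp (- p * B (ln \<rho>) / 2 + \<bar>ln \<rho> - x0\<bar> / 2) * \<rho>) * indicator {0<..} \<rho> \<partial>lborel)
    \<le> (\<integral>\<^sup>+\<rho>. ennreal (exp (p / 2) * (r * exp (- \<alpha> * (1 - \<rho> / r)))) * indicator {0..r} \<rho> +
      ennreal (exp (p / 2) * (r\<^sup>2 / \<rho> * exp (- \<alpha> * (ln \<rho> - x0)))) * indicator {r..} \<rho> \<partial>lborel)"
  proof (rule nn_integral_mono)
    fix \<rho> :: real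
    show "ennreal (exp (- p * B (ln \<rho>) / 2 + \<bar>ln \<rho> - x0\<bar> / 2) * \<rho>) * indicator {0<..} \<rho> \<le>
      ennreal (exp (p / 2) * (r * exp (- \<alpha> * (1 - \<rho> / r)))) * indicator {0..r} \<rho> +
      ennreal (exp (p / 2) * (r\<^sup>2 / \<rho> * exp (- \<alpha> * (ln \<rho> - x0)))) * indicator {r..} \<rho>"
    proof (cases "\<rho> > 0")
      case True
      have "ennreal (exp (- p * B (ln \<rho>) / 2 + \<bar>ln \<rho> - x0\<bar> / 2) * \<rho>) \<le>
        ennreal (exp (p / 2) * (r * exp (- \<alpha> * (1 - \<rho> / r))) * indicator {0..r} \<rho>) +
        ennreal (exp (p / 2) * (r\<^sup>2 / \<rho> * exp (- \<alpha> * (ln \<rho> - x0))) * indicator {r..} \<rho>)"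
        by (rule order.trans[OF ennreal_leI[OF le[OF True]]], subst ennreal_plus)
           (use True r in \<open>auto intro!: mult_nonneg_nonneg divide_nonneg_nonneg\<close>)
      moreover have "ennreal (C * indicator S \<rho>) = ennreal C * indicator S \<rho>" for C S
        by (simp split: split_indicator)
      moreover have "indicator {0<..} \<rho> = (1 :: ennreal)" using True by simp
      ultimately show ?thesis by (simp only: mult_1_right)
    qed simp
  qed
  also have "\<dots> = ennreal (exp (p / 2) * (r\<^sup>2 / \<alpha> * exp (- \<alpha> * (1 - r / r))) - exp (p / 2) * (r\<^sup>2 / \<alpha> * exp (- \<alpha> * (1 - 0 / r))))
     + ennreal (0 - (- exp (p / 2) * (r\<^sup>2 / \<alpha> * exp (- \<alpha> * (ln r - x0)))))"
    by (subst nn_integral_add) (simp_all only: I1 I2, measurable)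
  also have "\<dots> \<le> ennreal (exp (p / 2) * (r\<^sup>2 / \<alpha>)) + ennreal (exp (p / 2) * (r\<^sup>2 / \<alpha>))"
    using r \<alpha> by (intro add_mono ennreal_leI) auto
  also have "\<dots> = ennreal (exp (p / 2) * (r\<^sup>2 / \<alpha>) + exp (p / 2) * (r\<^sup>2 / \<alpha>))"
    using r \<alpha> by (subst ennreal_plus) auto
  also have "exp (p / 2) * (r\<^sup>2 / \<alpha>) + exp (p / 2) * (r\<^sup>2 / \<alpha>) = 8 * exp (p / 2) / p * w * exp (2 * x0)"
    using p w by (simp add: \<alpha>_def r_def exp_double)
  finally show ?thesis .
qed

section \<open>A criterion for unboundedness\<close>

text \<open>Boundedness would force \<open>L\<close> below a constant times
  \<open>A powr (1 / p - 1 / q)\<close>, where \<open>1 / \<infinity>\<close> counts as 0. The final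
  disjunction lists the two situations in which this power is bounded, and \<open>K\<close> and
  \<open>c\<close> must serve every \<open>L\<close>.\<close>

lemma fock_unboundedI:
  fixes \<phi> :: "complex \<Rightarrow> real" and p q :: ennreal and K c :: real
  assumes p: "0 < p" and q: "0 < q" and \<phi>[measurable]: "\<phi> \<in> borel_measurable borel"
    and K: "K \<ge> 1" and c: "0 < c" "c \<le> 1"
    and test: "\<And>L :: real. \<exists>f E A. f holomorphic_on UNIV \<and> (\<forall>z. cmod (f z) * exp (- \<phi> z) \<le> K) \<and>
      E \<in> sets lborel \<and> emeasure lborel E < \<infinity> \<and> 0 < A \<and> c * A \<le> measure lborel E \<and>
      (\<forall>z\<in>E. L \<le> cmod (deriv f z) * exp (- \<phi> z)) \<and>
      (p \<noteq> \<infinity> \<longrightarrow> (\<integral>\<^sup>+z. ennreal ((cmod (f z) * exp (- \<phi> z)) powr enn2real p) \<partial>lborel) \<le> ennreal (K * A)) \<and>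
      (p \<le> q \<and> A \<le> K \<or> q \<le> p \<and> c \<le> A)"
  shows "\<not> fock_bounded p q \<phi> deriv"
proof
  assume "fock_bounded p q \<phi> deriv"
  then obtain C0 where C0: "\<And>f. f \<in> fock_space p \<phi> \<Longrightarrow>
      deriv f \<in> fock_space q \<phi> \<and> fock_norm q \<phi> (deriv f) \<le> C0 * fock_norm p \<phi> f"
    unfolding fock_bounded_def by blast
  \<comment> \<open>\<open>C0\<close> could be negative; replacing the norm of \<open>f\<close> by
    an upper bound needs a nonnegative constant.\<close>
  define C where "C = max C0 0"
  define s where "s = (if p = \<infinity> then 0 else 1 / enn2real p)"
  define t where "t = (if q = \<infinity> then 0 else 1 / enn2real q)"
  have Ppos: "enn2real p > 0" if "p \<noteq> \<infinity>"
    using p that by (simp add: enn2real_positive_iff less_top)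
  have Qpos: "enn2real q > 0" if "q \<noteq> \<infinity>"
    using q that by (simp add: enn2real_positive_iff less_top)
  have st0: "s \<ge> 0" "t \<ge> 0" by (auto simp: s_def t_def)
  have st1: "s \<ge> t" if "p \<le> q"
  proof (cases "q = \<infinity>")
    case False
    then have "p \<noteq> \<infinity>" using that by (auto simp: top_unique)
    moreover have "enn2real p \<le> enn2real q" using that False by (intro enn2real_mono) (auto simp: less_top)
    ultimately show ?thesis using Ppos Qpos False by (simp add: s_def t_def frac_le)
  qed (use st0 in \<open>simp add: t_def\<close>)
  have st2: "s \<le> t" if "q \<le> p"
  proof (cases "p = \<infinity>")
    case False
    then have "q \<noteq> \<infinity>" using that by (auto simp: top_unique)
    moreover have "enn2real q \<le> enn2real p" using that False by (intro enn2real_mono) (auto simp: less_top)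
    ultimately show ?thesis using Ppos Qpos False by (simp add: s_def t_def frac_le)
  qed (use st0 in \<open>simp add: s_def\<close>)
  define K1 where "K1 = (if p = \<infinity> then K else K powr s)"
  define c1 where "c1 = c powr t"
  have K1: "K1 > 0" and c1: "c1 > 0" using K c by (auto simp: K1_def c1_def)
  define D where "D = C * K1 / c1 * max (K powr (s - t)) (c powr (s - t))"
  have D: "D \<ge> 0" using K1 c1 K c by (simp add: D_def C_def le_max_iff_disj)
  \<comment> \<open>\<open>D\<close> does not depend on the test function and bounds the right-hand
    side for all admissible \<open>A\<close>, its two powers serving the cases
    \<open>p \<le> q\<close> and \<open>q \<le> p\<close>; any larger \<open>L\<close> is
    contradictory.\<close>
  define L where "L = D + 1"
  have L: "L > 0" using D by (simp add: L_def)
  obtain f E A where f: "f holomorphic_on UNIV" and fK: "\<And>z. cmod (f z) * exp (- \<phi> z) \<le> K"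
    and E: "E \<in> sets lborel" "emeasure lborel E < \<infinity>" and A: "0 < A" "c * A \<le> measure lborel E"
    and fE: "\<And>z. z \<in> E \<Longrightarrow> L \<le> cmod (deriv f z) * exp (- \<phi> z)"
    and fp: "p \<noteq> \<infinity> \<Longrightarrow> (\<integral>\<^sup>+z. ennreal ((cmod (f z) * exp (- \<phi> z)) powr enn2real p) \<partial>lborel) \<le> ennreal (K * A)"
    and pq: "p \<le> q \<and> A \<le> K \<or> q \<le> p \<and> c \<le> A"
    using test[of L] by blast
  have [measurable]: "f \<in> borel_measurable borel"
    using f by (intro borel_measurable_continuous_onI holomorphic_on_imp_continuous_on)
  have eqp: "cmod (g z) powr P * exp (- P * \<phi> z) = (cmod (g z) * exp (- \<phi> z)) powr P" for g P z
    by (simp add: powr_mult exp_powr_real mult.commute)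
  have fnorm: "f \<in> fock_space p \<phi> \<and> fock_norm p \<phi> f \<le> K1 * A powr s"
  proof (cases "p = \<infinity>")
    case True
    then show ?thesis using f fK A
      by (auto simp: fock_space_def fock_norm_def K1_def s_def intro!: bdd_aboveI2 cSUP_least)
  next
    case False
    have int: "integrable lborel (\<lambda>z. (cmod (f z) * exp (- \<phi> z)) powr enn2real p)"
      using fp[OF False] by (intro integrableI_nonneg) (auto intro: le_less_trans)
    have "ennreal (LINT z|lborel. (cmod (f z) * exp (- \<phi> z)) powr enn2real p) \<le> ennreal (K * A)"
      using fp[OF False] by (subst nn_integral_eq_integral[symmetric, OF int]) auto
    then have le: "(LINT z|lborel. (cmod (f z) * exp (- \<phi> z)) powr enn2real p) \<le> K * A"
      using K A by (subst (asm) ennreal_le_iff) auto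
    then have "(LINT z|lborel. (cmod (f z) * exp (- \<phi> z)) powr enn2real p) powr s \<le> (K * A) powr s"
      using st0 by (intro powr_mono2) auto
    then show ?thesis using int f False K A
      unfolding fock_space_def fock_norm_def eqp
      by (simp add: K1_def s_def powr_mult)
  qed
  have df: "deriv f \<in> fock_space q \<phi>" and dn: "fock_norm q \<phi> (deriv f) \<le> C0 * fock_norm p \<phi> f"
    using C0 fnorm by auto
  have "fock_norm p \<phi> f \<ge> 0"
  proof (cases "p = \<infinity>")
    case True
    have "0 \<le> cmod (f 0) * exp (- \<phi> 0)" by simp
    also have "\<dots> \<le> (SUP z. cmod (f z) * exp (- \<phi> z))"
      using fK by (intro cSUP_upper bdd_aboveI2) auto
    finally show ?thesis using True by (simp add: fock_norm_def)
  qed (simp add: fock_norm_def)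
  then have "C0 * fock_norm p \<phi> f \<le> C * (K1 * A powr s)"
    using fnorm by (intro mult_mono) (auto simp: C_def)
  with dn have up: "fock_norm q \<phi> (deriv f) \<le> C * (K1 * A powr s)" by simp
  have low: "L * (c * A) powr t \<le> fock_norm q \<phi> (deriv f)"
  proof (cases "q = \<infinity>")
    case True
    have "E \<noteq> {}"
    proof
      assume "E = {}"
      then have "c * A \<le> 0" using A by simp
      then show False using A(1) c(1) by (meson mult_pos_pos not_le)
    qed
    then obtain z where z: "z \<in> E" by blast
    have "L \<le> cmod (deriv f z) * exp (- \<phi> z)" using fE z by blast
    also have "\<dots> \<le> (SUP z. cmod (deriv f z) * exp (- \<phi> z))"
      using df True by (intro cSUP_upper) (auto simp: fock_space_def)
    finally show ?thesis using True A c by (simp add: fock_norm_def t_def)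
  next
    case False
    define Q where "Q = enn2real q"
    have Q: "Q > 0" using Qpos[OF False] by (simp add: Q_def)
    have int: "integrable lborel (\<lambda>z. (cmod (deriv f z) * exp (- \<phi> z)) powr Q)"
      using df False unfolding fock_space_def eqp by (simp add: Q_def)
    have "L powr Q * (c * A) \<le> L powr Q * measure lborel E"
      using A by (intro mult_left_mono) auto
    also have "\<dots> = (LINT z|lborel. L powr Q * indicator E z)"
      using E by simp
    also have "\<dots> \<le> (LINT z|lborel. (cmod (deriv f z) * exp (- \<phi> z)) powr Q)"
    proof (rule integral_mono[OF _ int])
      show "integrable lborel (\<lambda>z. L powr Q * indicator E z)" using E by simp
      fix z :: complex
      show "L powr Q * indicator E z \<le> (cmod (deriv f z) * exp (- \<phi> z)) powr Q"
        using fE[of z] L Q by (auto simp: indicator_def intro!: powr_mono2)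
    qed
    finally have "(L powr Q * (c * A)) powr (1 / Q) \<le>
        (LINT z|lborel. (cmod (deriv f z) * exp (- \<phi> z)) powr Q) powr (1 / Q)"
      using Q A c by (intro powr_mono2) auto
    moreover have "(L powr Q * (c * A)) powr (1 / Q) = L * (c * A) powr t"
      using Q L A c False by (simp add: powr_mult powr_powr t_def Q_def[symmetric])
    ultimately show ?thesis using False unfolding fock_norm_def eqp by (simp add: Q_def)
  qed
  have "L * (c1 * A powr t) \<le> C * (K1 * A powr s)"
    using up low A c by (simp add: powr_mult c1_def)
  then have "L \<le> C * K1 / c1 * (A powr s / A powr t)"
    using A c1 by (simp add: field_simps)
  also have "A powr s / A powr t = A powr (s - t)" by (rule powr_diff[symmetric])
  also have "C * K1 / c1 * A powr (s - t) \<le> D"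
    unfolding D_def
  proof (rule mult_left_mono)
    show "A powr (s - t) \<le> max (K powr (s - t)) (c powr (s - t))"
      using pq
    proof
      assume "p \<le> q \<and> A \<le> K"
      then have "A powr (s - t) \<le> K powr (s - t)" using st1 A by (intro powr_mono2) auto
      then show ?thesis by simp
    next
      assume "q \<le> p \<and> c \<le> A"
      then have "A powr (s - t) \<le> c powr (s - t)" using st2 A c by (intro powr_mono2') auto
      then show ?thesis by simp
    qed
    show "0 \<le> C * K1 / c1" using K1 c1 by (simp add: C_def)
  qed
  finally show False by (simp add: L_def)
qed

section \<open>Log-convex weights\<close>

lemma cosh_le_exp_abs: "cosh u \<le> exp \<bar>u\<bar>" for u :: real
  by (cases "u \<ge> 0") (auto simp: cosh_def)

text \<open>The mean of \<open>exp v \<le> 1 + v + v ^ 2\<close> and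
  \<open>exp (- v) \<le> 1 - v + v ^ 2\<close>. The second holds because
  \<open>1 - v + v ^ 2\<close> times the quadratic Taylor polynomial of \<open>exp v\<close> is at
  least 1.\<close>

lemma cosh_le_quadratic:
  fixes u :: real
  assumes "\<bar>u\<bar> \<le> 1"
  shows "cosh u \<le> 1 + u\<^sup>2"
proof -
  define v where "v = \<bar>u\<bar>"
  have v: "0 \<le> v" "v \<le> 1" using assms by (auto simp: v_def)
  have 1: "exp v \<le> 1 + v + v\<^sup>2" using v by (rule exp_bound)
  have pos: "1 + v + v\<^sup>2 / 2 > 0" using v by (intro add_pos_nonneg) auto
  have "1 \<le> 1 + v\<^sup>2 / 2 + v ^ 3 / 2 + v ^ 4 / 2" using v by simp
  also have "\<dots> = (1 - v + v\<^sup>2) * (1 + v + v\<^sup>2 / 2)" by (simp add: field_simps power2_eq_square power3_eq_cube power4_eq_xxxx)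
  finally have 2: "inverse (1 + v + v\<^sup>2 / 2) \<le> 1 - v + v\<^sup>2" using pos by (simp add: field_simps)
  have "exp (- v) = inverse (exp v)" by (rule exp_minus)
  also have "\<dots> \<le> inverse (1 + v + v\<^sup>2 / 2)"
    using exp_lower_Taylor_quadratic[of v] v pos by (intro le_imp_inverse_le) auto
  finally have "exp (- v) \<le> 1 - v + v\<^sup>2" using 2 by simp
  then have "cosh v \<le> 1 + v\<^sup>2" using 1 by (simp add: cosh_def)
  then show ?thesis by (simp add: v_def)
qed

lemma eventually_le_exp:
  fixes a b c s :: real
  assumes "a > 0" "b > 0"
  shows "\<forall>\<^sub>F x in at_top. s \<le> a * exp (c + b * x)"
proof -
  have "filterlim (\<lambda>x. a * exp (c + b * x)) at_top at_top"
    using assms by (intro filterlim_tendsto_pos_mult_at_top[OF tendsto_const] filterlim_compose[OF exp_at_top]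
      filterlim_tendsto_add_at_top[OF tendsto_const] filterlim_ident) auto
  then show ?thesis unfolding filterlim_at_top by blast
qed

text \<open>The profile is taken in the variable \<open>ln |z|\<close>, so \<open>W\<close> is
  linked to it only off the origin. The origin is a null set, and the test functions below vanish
  there.\<close>

locale log_convex_weight =
  fixes W :: "complex \<Rightarrow> real" and \<phi> \<nu> \<phi>2 :: "real \<Rightarrow> real" and c0 X0 :: real
  assumes W_measurable [measurable]: "W \<in> borel_measurable borel"
    and W_eq: "z \<noteq> 0 \<Longrightarrow> W z = \<phi> (ln (cmod z))"
    and D_\<phi>: "(\<phi> has_real_derivative \<nu> x) (at x)"
    and D_\<nu>: "(\<nu> has_real_derivative \<phi>2 x) (at x)"
    and \<phi>2_pos: "\<phi>2 x > 0"
    and c0: "c0 > 0"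
    and \<phi>2_ge: "x \<ge> X0 \<Longrightarrow> \<phi>2 x \<ge> c0 * exp (2 * x)"
begin

text \<open>The Bregman divergence of \<open>\<phi>\<close>: if \<open>\<nu> y = n\<close>, then \<open>|z| ^ n exp (- W z)\<close> is a
  constant times \<open>exp (- breg y (ln |z|))\<close>.\<close>

definition breg :: "real \<Rightarrow> real \<Rightarrow> real" where
  "breg y x = \<phi> x - \<phi> y - \<nu> y * (x - y)"

text \<open>On \<open>[y - 1, y + 1]\<close> the second derivative is at least
  \<open>c0 * exp (- 2) * exp (2 * y)\<close>; the division by 2 is the one in the quadratic Taylor
  term.\<close>

definition \<kappa> :: real where "\<kappa> = c0 * exp (- 2) / 2"

lemma \<kappa>_pos: "\<kappa> > 0" using c0 by (simp add: \<kappa>_def)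

lemma \<phi>_measurable [measurable]: "\<phi> \<in> borel_measurable borel"
  by (intro borel_measurable_continuous_onI continuous_at_imp_continuous_on ballI)
     (metis D_\<phi> DERIV_isCont)

lemma breg_measurable [measurable]: "breg y \<in> borel_measurable borel"
  unfolding breg_def[abs_def] by measurable

lemma \<nu>_strict_mono: "x < y \<Longrightarrow> \<nu> x < \<nu> y"
  using DERIV_pos_imp_increasing[of x y \<nu>] D_\<nu> \<phi>2_pos by blast

lemma \<nu>_mono: "x \<le> y \<Longrightarrow> \<nu> x \<le> \<nu> y"
  using \<nu>_strict_mono[of x y] by (cases "x = y") auto

lemma breg_self [simp]: "breg y y = 0"
  by (simp add: breg_def)

lemma D_breg: "(breg y has_real_derivative \<nu> x - \<nu> y) (at x)"
  unfolding breg_def[abs_def] by (auto intro!: derivative_eq_intros D_\<phi>)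

text \<open>\<open>\<phi> x\<close> cancels, so two divergences differ by an affine function of
  \<open>x\<close> whose slope is the difference of the two exponents. All comparisons between
  neighbouring peaks rest on this.\<close>

lemma breg_three_point: "breg y x - breg z x = (\<nu> z - \<nu> y) * (x - z) + breg y z"
  by (simp add: breg_def algebra_simps)

lemma breg_mono_right: "y \<le> x \<Longrightarrow> x \<le> x' \<Longrightarrow> breg y x \<le> breg y x'"
  by (rule DERIV_nonneg_imp_nondecreasing[of x x']) (use D_breg \<nu>_mono in \<open>force+\<close>)

lemma breg_mono_left: "x \<le> y \<Longrightarrow> x' \<le> x \<Longrightarrow> breg y x \<le> breg y x'"
  by (rule DERIV_nonpos_imp_nonincreasing[of x' x]) (use D_breg \<nu>_mono in \<open>force+\<close>)

lemma breg_nonneg: "breg y x \<ge> 0"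
  using breg_mono_right[of y y x] breg_mono_left[of y y x] by (cases "y \<le> x") auto

lemma breg_convex: "convex_on UNIV (breg y)"
  by (rule convex_on_realI[where f' = "\<lambda>x. \<nu> x - \<nu> y"]) (auto intro: D_breg \<nu>_mono)

text \<open>Convexity together with the zero at \<open>y\<close>. Read from left to right it
  propagates a lower bound outwards with linear growth.\<close>

lemma breg_scale:
  assumes "0 < s" "s \<le> 1"
  shows "breg y (y + s * u) \<le> s * breg y (y + u)"
proof -
  have "breg y ((1 - s) *\<^sub>R y + s *\<^sub>R (y + u)) \<le> (1 - s) * breg y y + s * breg y (y + u)"
    using assms by (intro convex_onD[OF breg_convex]) auto
  then show ?thesis by (simp add: algebra_simps)
qed

lemma breg_ge_quadratic:
  assumes y: "y \<ge> X0 + 1" and u: "\<bar>u\<bar> \<le> 1"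
  shows "\<kappa> * exp (2 * y) * u\<^sup>2 \<le> breg y (y + u)"
proof -
  define k where "k = c0 * exp (2 * (y - 1))"
  have k: "\<kappa> * exp (2 * y) = k / 2" 
    using exp_add[of "2 * y" "- 2"] by (simp add: \<kappa>_def k_def algebra_simps)
  have mono: "\<nu> x - k * x \<le> \<nu> x' - k * x'" if "y - 1 \<le> x" "x \<le> x'" for x x'
  proof (rule DERIV_nonneg_imp_nondecreasing[OF that(2)])
    fix z assume z: "x \<le> z" "z \<le> x'"
    have "k \<le> c0 * exp (2 * z)" unfolding k_def using z that c0 by (intro mult_left_mono) auto
    also have "\<dots> \<le> \<phi>2 z" using z that y by (intro \<phi>2_ge) auto
    finally show "\<exists>d. ((\<lambda>x. \<nu> x - k * x) has_real_derivative d) (at z) \<and> 0 \<le> d"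
      by (intro exI[of _ "\<phi>2 z - k"]) (auto intro!: derivative_eq_intros D_\<nu>)
  qed
  \<comment> \<open>This is the Bregman divergence of \<open>\<phi>\<close> minus the parabola
    \<open>k * x ^ 2 / 2\<close>, which is still convex from \<open>y - 1\<close> onwards; hence it
    is smallest at \<open>y\<close>.\<close>
  define h where "h = (\<lambda>x. breg y x - k / 2 * (x - y)\<^sup>2)"
  have Dh: "(h has_real_derivative (\<nu> x - k * x) - (\<nu> y - k * y)) (at x)" for x
    unfolding h_def by (auto intro!: derivative_eq_intros D_breg simp: field_simps)
  have "h y \<le> h (y + u)"
  proof (cases "u \<ge> 0")
    case True
    then show ?thesis
      by (intro DERIV_nonneg_imp_nondecreasing[of y "y + u" h]) (use Dh mono[of y] in \<open>force+\<close>)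
  next
    case False
    then show ?thesis
      by (intro DERIV_nonpos_imp_nonincreasing[of "y + u" y h]) (use Dh mono[of _ y] u in \<open>force+\<close>)
  qed
  then show ?thesis by (simp add: h_def k)
qed

text \<open>Far to the left of \<open>y\<close> the bound for \<open>\<phi>2\<close> deteriorates,
  so the quadratic estimate is used only up to distance 1 and continued linearly by
  convexity.\<close>

lemma breg_ge:
  assumes y: "y \<ge> X0 + 1"
  shows "\<kappa> * exp (2 * y) * min (u\<^sup>2) \<bar>u\<bar> \<le> breg y (y + u)"
proof (cases "\<bar>u\<bar> \<le> 1")
  case True
  have "\<kappa> * exp (2 * y) * min (u\<^sup>2) \<bar>u\<bar> \<le> \<kappa> * exp (2 * y) * u\<^sup>2"
    using \<kappa>_pos by (intro mult_left_mono) auto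
  then show ?thesis using breg_ge_quadratic[OF y True] by simp
next
  case False
  define s where "s = 1 / \<bar>u\<bar>"
  have s: "0 < s" "s \<le> 1" "\<bar>s * u\<bar> = 1" using False by (auto simp: s_def abs_mult)
  have "\<kappa> * exp (2 * y) * (s * u)\<^sup>2 \<le> breg y (y + s * u)"
    using breg_ge_quadratic[OF y, of "s * u"] s by simp
  also have "\<dots> \<le> s * breg y (y + u)" using s by (intro breg_scale)
  finally have "\<kappa> * exp (2 * y) \<le> s * breg y (y + u)" using s(3) by (metis abs_1 mult.right_neutral one_power2 power2_abs)
  then have "\<kappa> * exp (2 * y) * \<bar>u\<bar> \<le> breg y (y + u)" using False by (simp add: s_def field_simps)
  moreover have "\<kappa> * exp (2 * y) * min (u\<^sup>2) \<bar>u\<bar> \<le> \<kappa> * exp (2 * y) * \<bar>u\<bar>"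
    using \<kappa>_pos by (intro mult_left_mono) auto
  ultimately show ?thesis by linarith
qed

text \<open>Integration of the bound for \<open>\<phi>2\<close> gives the factor
  \<open>c0 / 2\<close>; half of it is given up to absorb the constant of integration. With
  \<open>\<nu> y = n\<close> this is the lower bound for \<open>n / r\<close> by a multiple of
  \<open>r\<close>.\<close>

lemma \<nu>_ge: "\<exists>X1\<ge>X0. \<forall>x\<ge>X1. c0 / 4 * exp (2 * x) \<le> \<nu> x"
proof -
  have mono: "\<nu> X0 - c0 / 2 * exp (2 * X0) \<le> \<nu> x - c0 / 2 * exp (2 * x)" if "X0 \<le> x" for x
  proof (rule DERIV_nonneg_imp_nondecreasing[OF that])
    fix z assume "X0 \<le> z"
    then show "\<exists>d. ((\<lambda>x. \<nu> x - c0 / 2 * exp (2 * x)) has_real_derivative d) (at z) \<and> 0 \<le> d"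
      using \<phi>2_ge[of z] by (intro exI[of _ "\<phi>2 z - c0 * exp (2 * z)"]) (auto intro!: derivative_eq_intros D_\<nu>)
  qed
  have "eventually (\<lambda>x. c0 / 2 * exp (2 * X0) - \<nu> X0 \<le> c0 / 4 * exp (2 * x)) at_top"
    using eventually_le_exp[of "c0 / 4" 2 "c0 / 2 * exp (2 * X0) - \<nu> X0" 0] c0 by simp
  then obtain X where X: "\<And>x. x \<ge> X \<Longrightarrow> c0 / 2 * exp (2 * X0) - \<nu> X0 \<le> c0 / 4 * exp (2 * x)"
    by (auto simp: eventually_at_top_linorder)
  have "c0 / 4 * exp (2 * x) \<le> \<nu> x" if "x \<ge> max X X0" for x
    using X[of x] mono[of x] that by simp
  then show ?thesis by (intro exI[of _ "max X X0"]) auto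
qed

text \<open>Applied to integers \<open>s\<close>: it supplies a radius at which a given monomial has
  its weighted peak.\<close>

lemma \<nu>_surj:
  assumes "\<nu> X \<le> s"
  shows "\<exists>x\<ge>X. \<nu> x = s"
proof -
  obtain X1 where X1: "X1 \<ge> X0" "\<And>x. x \<ge> X1 \<Longrightarrow> c0 / 4 * exp (2 * x) \<le> \<nu> x" using \<nu>_ge by blast
  have "eventually (\<lambda>x. s \<le> c0 / 4 * exp (2 * x)) at_top"
    using eventually_le_exp[of "c0 / 4" 2 s 0] c0 by simp
  then obtain Y where Y: "\<And>x. x \<ge> Y \<Longrightarrow> s \<le> c0 / 4 * exp (2 * x)"
    by (auto simp: eventually_at_top_linorder)
  define Z where "Z = max X (max X1 Y)"
  have "s \<le> c0 / 4 * exp (2 * Z)" by (rule Y) (simp add: Z_def)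
  also have "\<dots> \<le> \<nu> Z" by (rule X1) (simp add: Z_def)
  finally have "s \<le> \<nu> Z" .
  then obtain x where "X \<le> x" "x \<le> Z" "\<nu> x = s"
    using IVT[of \<nu> X s Z] assms D_\<nu> by (auto simp: Z_def intro: DERIV_isCont)
  then show ?thesis by blast
qed

text \<open>The numbers \<open>a\<close> and \<open>b\<close> are the distances to the two points
  where the divergence is 1. They may differ greatly, yet \<open>a + b\<close> serves both as the
  length of the set where the peak is high and as the scale of its tails, so upper and lower
  estimates match.\<close>

lemma breg_widths:
  assumes y: "y \<ge> X0 + 1" "1 \<le> \<kappa> * exp (2 * y)"
  obtains a b where "0 < a" "a \<le> 1 / sqrt (\<kappa> * exp (2 * y))" "0 < b" "b \<le> 1 / sqrt (\<kappa> * exp (2 * y))"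
    "\<And>x. y - a \<le> x \<Longrightarrow> x \<le> y + b \<Longrightarrow> breg y x \<le> 1"
    "\<And>x. \<bar>x - y\<bar> / (a + b) - 1 \<le> breg y x"
proof -
  \<comment> \<open>At distance \<open>d\<close> the quadratic lower bound reaches 1; it may be used
    there because \<open>d \<le> 1\<close>.\<close>
  define d where "d = 1 / sqrt (\<kappa> * exp (2 * y))"
  have d: "0 < d" "d \<le> 1" using y(2) by (auto simp: d_def)
  have d2: "\<kappa> * exp (2 * y) * d\<^sup>2 = 1" using y(2) by (auto simp: d_def power_divide)
  have ge: "breg y (y + d) \<ge> 1" "breg y (y + - d) \<ge> 1"
    using breg_ge_quadratic[OF y(1), of d] breg_ge_quadratic[OF y(1), of "- d"] d d2 by auto
  have cont: "isCont (breg y) x" for x using D_breg DERIV_isCont by blast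
  obtain p where p: "y \<le> p" "p \<le> y + d" "breg y p = 1"
    using IVT[of "breg y" y 1 "y + d"] ge cont d by auto
  obtain q where q: "y - d \<le> q" "q \<le> y" "breg y q = 1"
    using IVT2[of "breg y" y 1 "y - d"] ge cont d by auto
  define a where "a = y - q"
  define b where "b = p - y"
  have ab: "a > 0" "b > 0" using p q by (auto simp: a_def b_def less_le)
  have main: "u / b \<le> breg y (y + u)" if "u \<ge> b" for u
  proof -
    have "breg y (y + b / u * u) \<le> b / u * breg y (y + u)"
      using that ab by (intro breg_scale) auto
    then show ?thesis using that ab p(3) by (simp add: b_def field_simps)
  qed
  have main': "u / a \<le> breg y (y - u)" if "u \<ge> a" for u
  proof -
    have "breg y (y + a / u * (- u)) \<le> a / u * breg y (y + (- u))"
      using that ab by (intro breg_scale) auto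
    then show ?thesis using that ab q(3) by (simp add: a_def field_simps)
  qed
  show ?thesis
  proof (rule that[of a b])
    fix x assume "y - a \<le> x" "x \<le> y + b"
    then show "breg y x \<le> 1"
      using breg_mono_right[of y x p] breg_mono_left[of x y q] p q by (cases "y \<le> x") (auto simp: a_def b_def)
  next
    fix x
    \<comment> \<open>Beyond either level point the divergence grows linearly at its own rate, which
      is at least \<open>1 / (a + b)\<close>; close to \<open>y\<close> the subtracted 1 makes the
      claim trivial.\<close>
    consider "x - y \<ge> b" | "y - x \<ge> a" | "\<bar>x - y\<bar> \<le> a + b" using ab by linarith
    then show "\<bar>x - y\<bar> / (a + b) - 1 \<le> breg y x"
    proof cases
      case 1
      have "\<bar>x - y\<bar> / (a + b) \<le> (x - y) / b" using 1 ab by (intro frac_le) auto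
      then show ?thesis using main[OF 1] by simp
    next
      case 2
      have "\<bar>x - y\<bar> / (a + b) \<le> (y - x) / a" using 2 ab by (intro frac_le) auto
      then show ?thesis using main'[OF 2] by simp
    next
      case 3
      then have "\<bar>x - y\<bar> / (a + b) \<le> 1" using ab by simp
      then show ?thesis using breg_nonneg[of y x] by linarith
    qed
  qed (use p q ab in \<open>auto simp: a_def b_def d_def\<close>)
qed

lemma nn_integral_radial_peak_le:
  assumes p: "p > 0" and w: "w > 0" "10 * w \<le> p"
    and B: "\<And>x. breg y x \<ge> \<bar>x - y\<bar> / w - 1"
  shows "(\<integral>\<^sup>+z. ennreal (exp (- p * breg y (ln (cmod z)))) \<partial>lborel)
     \<le> ennreal (16 * pi * exp (p / 2) / p * w * exp (2 * y))"
proof -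
  define I where "I = (\<integral>\<^sup>+\<rho>. ennreal (exp (- p * breg y (ln \<rho>) / 2 + \<bar>ln \<rho> - y\<bar> / 2) * \<rho>) * indicator {0<..} \<rho> \<partial>lborel)"
  have I: "I \<le> ennreal (8 * exp (p / 2) / p * w * exp (2 * y))"
    unfolding I_def by (rule nn_integral_peak_le) fact+
  \<comment> \<open>A plain radial peak decays faster than \<open>nn_integral_peak_le\<close> asks;
    its exponent is weakened to the shape treated there.\<close>
  have half: "- v \<le> - v / 2 + d / 2" if "v \<ge> 0" "d \<ge> 0" for v d :: real
    using that by (simp add: field_simps)
  have "(\<integral>\<^sup>+z. ennreal (exp (- p * breg y (ln (cmod z)))) \<partial>lborel) =
     (\<integral>\<^sup>+t. \<integral>\<^sup>+\<rho>. ennreal (\<bar>\<rho>\<bar> / (1 + t\<^sup>2)) * ennreal (exp (- p * breg y (ln \<bar>\<rho>\<bar>))) \<partial>lborel \<partial>lborel)"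
    by (subst nn_integral_polar) (simp_all only: polar_point, measurable)
  also have "\<dots> \<le> (\<integral>\<^sup>+t. ennreal (1 / (1 + 1 * t\<^sup>2)) * (2 * I) \<partial>lborel)"
  proof (rule nn_integral_mono)
    fix t :: real
    have "(\<integral>\<^sup>+\<rho>. ennreal (\<bar>\<rho>\<bar> / (1 + t\<^sup>2)) * ennreal (exp (- p * breg y (ln \<bar>\<rho>\<bar>))) \<partial>lborel) =
      (\<integral>\<^sup>+\<rho>. ennreal (1 / (1 + 1 * t\<^sup>2)) * ennreal (exp (- p * breg y (ln \<bar>\<rho>\<bar>)) * \<bar>\<rho>\<bar>) \<partial>lborel)"
      by (intro nn_integral_cong) (simp add: ennreal_mult'[symmetric] mult_ac)
    also have "\<dots> = ennreal (1 / (1 + 1 * t\<^sup>2)) *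
        (2 * (\<integral>\<^sup>+\<rho>. ennreal (exp (- p * breg y (ln \<rho>)) * \<rho>) * indicator {0<..} \<rho> \<partial>lborel))"
      using nn_integral_abs[of "\<lambda>\<rho>. ennreal (exp (- p * breg y (ln \<rho>)) * \<rho>)"]
      by (subst nn_integral_cmult) auto
    also have "\<dots> \<le> ennreal (1 / (1 + 1 * t\<^sup>2)) * (2 * I)"
      unfolding I_def
    proof (intro mult_left_mono nn_integral_mono)
      fix \<rho> :: real
      define v where "v = p * breg y (ln \<rho>)"
      have "v \<ge> 0" using p breg_nonneg by (simp add: v_def)
      then have "- v \<le> - v / 2 + \<bar>ln \<rho> - y\<bar> / 2"
        using half[OF _ abs_ge_zero] by blast
      then have "- p * breg y (ln \<rho>) \<le> - p * breg y (ln \<rho>) / 2 + \<bar>ln \<rho> - y\<bar> / 2"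
        by (simp only: v_def mult_minus_left)
      then show "ennreal (exp (- p * breg y (ln \<rho>)) * \<rho>) * indicator {0<..} \<rho>
         \<le> ennreal (exp (- p * breg y (ln \<rho>) / 2 + \<bar>ln \<rho> - y\<bar> / 2) * \<rho>) * indicator {0<..} \<rho>"
        by (auto simp: indicator_def intro!: ennreal_leI)
    qed auto
    finally show "(\<integral>\<^sup>+\<rho>. ennreal (\<bar>\<rho>\<bar> / (1 + t\<^sup>2)) * ennreal (exp (- p * breg y (ln \<bar>\<rho>\<bar>))) \<partial>lborel)
      \<le> ennreal (1 / (1 + 1 * t\<^sup>2)) * (2 * I)" .
  qed
  also have "\<dots> = ennreal pi * (2 * I)"
    by (subst nn_integral_multc) (use nn_integral_inverse_quadratic[of 1] in simp_all)
  also have "\<dots> \<le> ennreal pi * (ennreal 2 * ennreal (8 * exp (p / 2) / p * w * exp (2 * y)))"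
    using I by (intro mult_mono order.refl) auto
  also have "\<dots> = ennreal (16 * pi * exp (p / 2) / p * w * exp (2 * y))"
    using p w by (subst ennreal_mult'[symmetric], simp)+ (simp add: field_simps)
  finally show ?thesis .
qed

section \<open>Test functions localised at a point\<close>

text \<open>The monomial \<open>z ^ n\<close> times the angular factor with
  \<open>r = exp y\<close>, scaled so that for \<open>\<nu> y = n\<close> its weighted modulus is 1
  at \<open>z = r\<close>. As \<open>n - m\<close> is truncated, this reading needs
  \<open>m \<le> n\<close>.\<close>

definition bump :: "real \<Rightarrow> nat \<Rightarrow> nat \<Rightarrow> complex \<Rightarrow> complex" where
  "bump y n m z = of_real (exp (\<phi> y - n * y) / (4 * exp y) ^ m) * z ^ (n - m) * (z + of_real (exp y)) ^ (2 * m)"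

lemma norm_bump:
  assumes n: "\<nu> y = real n" "m \<le> n" and z: "z \<noteq> 0"
  shows "cmod (bump y n m z) * exp (- W z) =
    exp (- breg y (ln (cmod z))) * ((cmod (z + of_real (exp y)))\<^sup>2 / (4 * exp y * cmod z)) ^ m"
proof -
  define R where "R = cmod z"
  have R: "R > 0" "exp (ln R) = R" using z by (auto simp: R_def)
  define q where "q = (cmod (z + of_real (exp y)))\<^sup>2"
  have "cmod (bump y n m z) * exp (- W z) = exp (\<phi> y - n * y) / (4 * exp y) ^ m * R ^ (n - m) * q ^ m * exp (- \<phi> (ln R))"
    using z by (simp add: bump_def norm_mult norm_divide norm_power W_eq R_def q_def power_mult)
  also have "\<dots> = (exp (\<phi> y - n * y) * R ^ n * exp (- \<phi> (ln R))) * (q / (4 * exp y * R)) ^ m"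
    using R n by (simp add: power_diff power_divide power_mult_distrib)
  also have "R ^ n = exp (n * ln R)" using R by (simp add: exp_of_nat_mult)
  also have "exp (\<phi> y - n * y) * exp (n * ln R) * exp (- \<phi> (ln R)) = exp (- breg y (ln R))"
    by (simp add: exp_add[symmetric] breg_def n algebra_simps)
  finally show ?thesis by (simp add: R_def q_def)
qed

text \<open>The law of cosines splits the angular factor into a radial growth, to be absorbed by the
  divergence, and the loss \<open>(1 - cos) / 2\<close> in the angle.\<close>

lemma bump_ratio:
  fixes y :: real
  assumes z: "z \<noteq> 0"
  shows "(cmod (z + of_real (exp y)))\<^sup>2 / (4 * exp y * cmod z) =
     (1 + cosh (ln (cmod z) - y)) / 2 - (1 - Re z / cmod z) / 2"
proof -
  define R where "R = cmod z"
  define r where "r = exp y"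
  have R: "R > 0" "exp (ln R) = R" and r: "r > 0" using z by (auto simp: R_def r_def)
  have e1: "(cmod (z + of_real r))\<^sup>2 = R\<^sup>2 + 2 * r * Re z + r\<^sup>2"
    unfolding R_def cmod_power2 by (simp add: power2_eq_square algebra_simps)
  have e2: "cosh (ln R - y) = (R / r + r / R) / 2"
    using R by (simp add: cosh_def exp_diff exp_minus r_def field_simps)
  show ?thesis
    unfolding R_def[symmetric] e2 unfolding r_def[symmetric] e1
    using R r by (simp add: field_simps power2_eq_square)
qed

lemma norm_bump_le:
  assumes y: "y \<ge> X0 + 1" and n: "\<nu> y = real n" "m \<le> n" and m: "2 * real m \<le> \<kappa> * exp (2 * y)" and z: "z \<noteq> 0"
  shows "cmod (bump y n m z) * exp (- W z) \<le>
    exp (- breg y (ln (cmod z)) / 2 - m * exp (- \<bar>ln (cmod z) - y\<bar>) / 4 * (Im z / cmod z)\<^sup>2)"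
proof -
  define u where "u = ln (cmod z) - y"
  define b where "b = breg y (ln (cmod z))"
  define c where "c = Re z / cmod z"
  define C2 where "C2 = (1 + cosh u) / 2"
  define q where "q = (cmod (z + of_real (exp y)))\<^sup>2 / (4 * exp y * cmod z)"
  have q: "q = C2 - (1 - c) / 2"
    using bump_ratio[OF z, of y] by (simp only: q_def C2_def c_def u_def)
  have q0: "q \<ge> 0" by (simp add: q_def)
  have C2: "C2 \<ge> 1" using cosh_real_ge_1[of u] by (simp add: C2_def)
  have e1: "exp \<bar>u\<bar> \<ge> 1" by simp
  have C2u: "C2 \<le> exp \<bar>u\<bar>" using add_mono[OF e1 cosh_le_exp_abs[of u]] by (simp add: C2_def)
  \<comment> \<open>The minimum is the one in \<open>breg_ge\<close>; thus \<open>m\<close> copies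
    of \<open>C2\<close> cost at most half of the divergence.\<close>
  have C2le: "C2 \<le> exp (min (u\<^sup>2) \<bar>u\<bar>)"
  proof (cases "\<bar>u\<bar> \<le> 1")
    case True
    have "1 \<le> 1 + u\<^sup>2" by simp
    from add_mono[OF this cosh_le_quadratic[OF True]] have "C2 \<le> 1 + u\<^sup>2" by (simp add: C2_def)
    also have "\<dots> \<le> exp (u\<^sup>2)" by (rule exp_ge_add_one_self)
    also have "u\<^sup>2 = min (u\<^sup>2) \<bar>u\<bar>"
      using True by (simp add: power2_eq_square min_def) (metis abs_mult_self_eq abs_ge_zero mult_left_le)
    finally show ?thesis .
  next
    case False
    have "\<bar>u\<bar> * 1 \<le> \<bar>u\<bar> * \<bar>u\<bar>" using False by (intro mult_left_mono) auto
    then have "min (u\<^sup>2) \<bar>u\<bar> = \<bar>u\<bar>" by (simp add: power2_eq_square)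
    then show ?thesis using C2u by simp
  qed
  \<comment> \<open>With \<open>C2\<close> taken out, the remaining factor is bounded by
    \<open>1 - x \<le> exp (- x)\<close>, so its power decays exponentially.\<close>
  have "q = C2 * (1 - (1 - c) / (2 * C2))" using C2 by (simp add: q field_simps)
  also have "\<dots> \<le> C2 * exp (- ((1 - c) / (2 * C2)))"
    using exp_ge_add_one_self[of "- ((1 - c) / (2 * C2))"] C2 by (intro mult_left_mono) auto
  finally have qle: "q \<le> C2 * exp (- ((1 - c) / (2 * C2)))" .
  have "C2 ^ m \<le> exp (min (u\<^sup>2) \<bar>u\<bar>) ^ m" using C2 C2le by (intro power_mono) auto
  also have "\<dots> = exp (m * min (u\<^sup>2) \<bar>u\<bar>)" by (simp only: exp_of_nat_mult)
  also have "\<dots> \<le> exp (b / 2)"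
  proof -
    have "2 * real m * min (u\<^sup>2) \<bar>u\<bar> \<le> \<kappa> * exp (2 * y) * min (u\<^sup>2) \<bar>u\<bar>"
      using m by (intro mult_right_mono) auto
    also have "\<dots> \<le> b" using breg_ge[OF y, of u] by (simp add: b_def u_def)
    finally show ?thesis by simp
  qed
  finally have C2m: "C2 ^ m \<le> exp (b / 2)" .
  have c1: "\<bar>c\<bar> \<le> 1" using abs_Re_le_cmod[of z] z by (simp add: c_def)
  have "(Im z / cmod z)\<^sup>2 = 1 - c\<^sup>2"
  proof -
    have "(Im z)\<^sup>2 = (cmod z)\<^sup>2 - (Re z)\<^sup>2" using cmod_power2[of z] by linarith
    then show ?thesis using z by (simp only: c_def power_divide diff_divide_distrib) simp
  qed
  \<comment> \<open>Passing from \<open>1 - c\<close> to the squared sine gives up the decay near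
    the negative axis, but the sine depends on the slope alone and not on the sign of the radius.
    This affects only constants.\<close>
  also have "1 - c\<^sup>2 = (1 - c) * (1 + c)" by (simp add: power2_eq_square algebra_simps)
  also have "\<dots> \<le> (1 - c) * 2" using c1 by (intro mult_left_mono) auto
  finally have Im: "(Im z / cmod z)\<^sup>2 \<le> (1 - c) * 2" .
  have "exp (- \<bar>u\<bar>) / 4 * (Im z / cmod z)\<^sup>2 \<le> exp (- \<bar>u\<bar>) / 4 * ((1 - c) * 2)"
    using Im by (intro mult_left_mono) auto
  also have "\<dots> = (1 - c) / (2 * exp \<bar>u\<bar>)" by (simp add: exp_minus field_simps)
  also have "\<dots> \<le> (1 - c) / (2 * C2)" using c1 C2 C2u by (intro divide_left_mono) auto
  finally have ang: "exp (- \<bar>u\<bar>) / 4 * (Im z / cmod z)\<^sup>2 \<le> (1 - c) / (2 * C2)" .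
  have "cmod (bump y n m z) * exp (- W z) = exp (- b) * q ^ m"
    using norm_bump[OF n z] by (simp add: b_def q_def)
  also have "\<dots> \<le> exp (- b) * (C2 * exp (- ((1 - c) / (2 * C2)))) ^ m"
    using q0 qle by (intro mult_left_mono power_mono) auto
  also have "\<dots> = exp (- b) * (C2 ^ m * exp (- (m * ((1 - c) / (2 * C2)))))"
    by (simp add: power_mult_distrib exp_of_nat_mult[symmetric])
  also have "\<dots> \<le> exp (- b) * (exp (b / 2) * exp (- (m * (exp (- \<bar>u\<bar>) / 4 * (Im z / cmod z)\<^sup>2))))"
  proof (intro mult_left_mono mult_mono C2m)
    have "m * (exp (- \<bar>u\<bar>) / 4 * (Im z / cmod z)\<^sup>2) \<le> m * ((1 - c) / (2 * C2))"
      by (intro mult_left_mono ang) simp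
    then show "exp (- (m * ((1 - c) / (2 * C2)))) \<le> exp (- (m * (exp (- \<bar>u\<bar>) / 4 * (Im z / cmod z)\<^sup>2)))"
      by (simp only: exp_le_cancel_iff neg_le_iff_le)
  qed simp_all
  also have "\<dots> = exp (- b / 2 - m * exp (- \<bar>u\<bar>) / 4 * (Im z / cmod z)\<^sup>2)"
    by (simp add: exp_add[symmetric] algebra_simps)
  finally show ?thesis by (simp add: b_def u_def)
qed

text \<open>The angle is integrated first. Its Gaussian-like factor is replaced by a rational one,
  which combines with the polar density to \<open>1 / (1 + k * t ^ 2)\<close>. The integral
  \<open>pi / sqrt k\<close> produces the gain \<open>1 / sqrt m\<close> and the loss
  \<open>exp (\<bar>ln \<rho> - y\<bar> / 2)\<close>.\<close>

lemma nn_integral_bump_le: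
  assumes y: "y \<ge> X0 + 1" and n: "\<nu> y = real n" "m \<le> n" and m: "2 * real m \<le> \<kappa> * exp (2 * y)" "m > 0"
    and p: "p > 0" and w: "w > 0" "10 * w \<le> p"
    and B: "\<And>x. breg y x \<ge> \<bar>x - y\<bar> / w - 1"
  shows "(\<integral>\<^sup>+z. ennreal ((cmod (bump y n m z) * exp (- W z)) powr p) \<partial>lborel)
    \<le> ennreal (32 * pi * exp (p / 2) / (p * sqrt p) * (w * exp (2 * y) / sqrt m))"
proof -
  define H where "H = (\<lambda>\<rho>. exp (- p * breg y (ln \<rho>) / 2) * \<rho>)"
  define k where "k = (\<lambda>\<rho>. p * m * exp (- \<bar>ln \<rho> - y\<bar>) / 4)"
  have kpos: "k \<rho> > 0" for \<rho> using p m by (simp add: k_def)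
  have [measurable]: "H \<in> borel_measurable borel" "k \<in> borel_measurable borel"
    unfolding H_def k_def by measurable
  have [measurable]: "bump y n m \<in> borel_measurable borel"
    unfolding bump_def[abs_def] by (intro borel_measurable_continuous_onI continuous_intros)
  define I where "I = (\<integral>\<^sup>+\<rho>. ennreal (exp (- p * breg y (ln \<rho>) / 2 + \<bar>ln \<rho> - y\<bar> / 2) * \<rho>) * indicator {0<..} \<rho> \<partial>lborel)"
  have I: "I \<le> ennreal (8 * exp (p / 2) / p * w * exp (2 * y))"
    unfolding I_def by (rule nn_integral_peak_le) fact+
  have pt: "\<bar>\<rho>\<bar> / (1 + t\<^sup>2) * ((cmod (bump y n m z) * exp (- W z)) powr p) \<le> H \<bar>\<rho>\<bar> * (1 / (1 + k \<bar>\<rho>\<bar> * t\<^sup>2))"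
    if z: "z = Complex (\<rho> / sqrt (1 + t\<^sup>2)) (t * \<rho> / sqrt (1 + t\<^sup>2))" for \<rho> t z
  proof (cases "\<rho> = 0")
    case False
    define K where "K = k \<bar>\<rho>\<bar>"
    have K: "K > 0" using kpos by (simp add: K_def)
    have pos: "1 + t\<^sup>2 > 0" using add_pos_nonneg[of 1 "t\<^sup>2"] by simp
    have c: "cmod z = \<bar>\<rho>\<bar>" and im: "(Im z / cmod z)\<^sup>2 = t\<^sup>2 / (1 + t\<^sup>2)"
      using polar_point[of \<rho> t] False unfolding z by auto
    have z0: "z \<noteq> 0" using c False by auto
    have "(cmod (bump y n m z) * exp (- W z)) powr p \<le>
       exp (- breg y (ln (cmod z)) / 2 - m * exp (- \<bar>ln (cmod z) - y\<bar>) / 4 * (Im z / cmod z)\<^sup>2) powr p"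
      using norm_bump_le[OF y n m(1) z0] p by (intro powr_mono2) auto
    also have "\<dots> = exp (- p * breg y (ln \<bar>\<rho>\<bar>) / 2) * exp (- (K * (t\<^sup>2 / (1 + t\<^sup>2))))"
      unfolding im unfolding c by (simp add: exp_powr_real exp_add[symmetric] K_def k_def field_simps)
    also have "exp (- (K * (t\<^sup>2 / (1 + t\<^sup>2)))) \<le> 1 / (1 + K * (t\<^sup>2 / (1 + t\<^sup>2)))"
      using exp_ge_add_one_self[of "K * (t\<^sup>2 / (1 + t\<^sup>2))"] K pos
      by (simp add: exp_minus inverse_eq_divide) (intro frac_le, auto intro: add_pos_nonneg)
    finally have "\<bar>\<rho>\<bar> / (1 + t\<^sup>2) * ((cmod (bump y n m z) * exp (- W z)) powr p) \<le>
       \<bar>\<rho>\<bar> / (1 + t\<^sup>2) * (exp (- p * breg y (ln \<bar>\<rho>\<bar>) / 2) * (1 / (1 + K * (t\<^sup>2 / (1 + t\<^sup>2)))))"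
      using pos by (intro mult_left_mono) auto
    also have "\<dots> = H \<bar>\<rho>\<bar> * (1 / ((1 + t\<^sup>2) * (1 + K * (t\<^sup>2 / (1 + t\<^sup>2)))))"
      by (simp add: H_def)
    also have "(1 + t\<^sup>2) * (1 + K * (t\<^sup>2 / (1 + t\<^sup>2))) = 1 + t\<^sup>2 + K * t\<^sup>2"
      using pos by (simp add: field_simps)
    also have "H \<bar>\<rho>\<bar> * (1 / (1 + t\<^sup>2 + K * t\<^sup>2)) \<le> H \<bar>\<rho>\<bar> * (1 / (1 + K * t\<^sup>2))"
      using K by (intro mult_left_mono frac_le) (auto simp: H_def intro: add_pos_nonneg)
    finally show ?thesis by (simp add: K_def)
  qed (simp add: H_def)
  have "(\<integral>\<^sup>+z. ennreal ((cmod (bump y n m z) * exp (- W z)) powr p) \<partial>lborel) =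
    (\<integral>\<^sup>+t. \<integral>\<^sup>+\<rho>. ennreal (\<bar>\<rho>\<bar> / (1 + t\<^sup>2)) * ennreal ((cmod (bump y n m (Complex (\<rho> / sqrt (1 + t\<^sup>2)) (t * \<rho> / sqrt (1 + t\<^sup>2))))
       * exp (- W (Complex (\<rho> / sqrt (1 + t\<^sup>2)) (t * \<rho> / sqrt (1 + t\<^sup>2))))) powr p) \<partial>lborel \<partial>lborel)"
    by (rule nn_integral_polar) measurable
  also have "\<dots> \<le> (\<integral>\<^sup>+t. \<integral>\<^sup>+\<rho>. ennreal (H \<bar>\<rho>\<bar>) * ennreal (1 / (1 + k \<bar>\<rho>\<bar> * t\<^sup>2)) \<partial>lborel \<partial>lborel)"
  proof (intro nn_integral_mono)
    fix t \<rho> :: real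
    let ?z = "Complex (\<rho> / sqrt (1 + t\<^sup>2)) (t * \<rho> / sqrt (1 + t\<^sup>2))"
    have "ennreal (\<bar>\<rho>\<bar> / (1 + t\<^sup>2) * ((cmod (bump y n m ?z) * exp (- W ?z)) powr p)) \<le> ennreal (H \<bar>\<rho>\<bar> * (1 / (1 + k \<bar>\<rho>\<bar> * t\<^sup>2)))"
      by (intro ennreal_leI pt) simp
    then show "ennreal (\<bar>\<rho>\<bar> / (1 + t\<^sup>2)) * ennreal ((cmod (bump y n m ?z) * exp (- W ?z)) powr p)
       \<le> ennreal (H \<bar>\<rho>\<bar>) * ennreal (1 / (1 + k \<bar>\<rho>\<bar> * t\<^sup>2))"
      by (subst (asm) (1 2) ennreal_mult') (auto simp: H_def)
  qed
  also have "\<dots> = (\<integral>\<^sup>+\<rho>. \<integral>\<^sup>+t. ennreal (H \<bar>\<rho>\<bar>) * ennreal (1 / (1 + k \<bar>\<rho>\<bar> * t\<^sup>2)) \<partial>lborel \<partial>lborel)"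
    by (rule lborel_pair.Fubini') measurable
  also have "\<dots> = (\<integral>\<^sup>+\<rho>. ennreal (2 * pi / sqrt (p * m)) * ennreal (exp (- p * breg y (ln \<bar>\<rho>\<bar>) / 2 + \<bar>ln \<bar>\<rho>\<bar> - y\<bar> / 2) * \<bar>\<rho>\<bar>) \<partial>lborel)"
  proof (rule nn_integral_cong)
    fix \<rho> :: real
    define s where "s = \<bar>ln \<bar>\<rho>\<bar> - y\<bar>"
    have sq: "sqrt (exp (- s)) = exp (- s / 2)"
      by (rule real_sqrt_unique) (auto simp: exp_double[symmetric])
    have "(\<integral>\<^sup>+t. ennreal (H \<bar>\<rho>\<bar>) * ennreal (1 / (1 + k \<bar>\<rho>\<bar> * t\<^sup>2)) \<partial>lborel) = ennreal (H \<bar>\<rho>\<bar>) * ennreal (pi / sqrt (k \<bar>\<rho>\<bar>))"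
      by (subst nn_integral_cmult) (use nn_integral_inverse_quadratic[OF kpos] in simp_all)
    also have "\<dots> = ennreal (H \<bar>\<rho>\<bar> * (pi / sqrt (k \<bar>\<rho>\<bar>)))"
      by (rule ennreal_mult'[symmetric]) (simp add: H_def)
    also have "sqrt (k \<bar>\<rho>\<bar>) = sqrt (p * m) * exp (- s / 2) / 2"
      unfolding k_def s_def[symmetric] real_sqrt_divide real_sqrt_mult sq by simp
    also have "H \<bar>\<rho>\<bar> * (pi / (sqrt (p * m) * exp (- s / 2) / 2)) =
       (2 * pi / sqrt (p * m)) * (exp (- p * breg y (ln \<bar>\<rho>\<bar>) / 2 + s / 2) * \<bar>\<rho>\<bar>)"
      by (simp only: H_def exp_add exp_minus minus_divide_left[symmetric]) (simp add: field_simps)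
    also have "ennreal \<dots> = ennreal (2 * pi / sqrt (p * m)) * ennreal (exp (- p * breg y (ln \<bar>\<rho>\<bar>) / 2 + s / 2) * \<bar>\<rho>\<bar>)"
      using p by (intro ennreal_mult') auto
    finally show "(\<integral>\<^sup>+t. ennreal (H \<bar>\<rho>\<bar>) * ennreal (1 / (1 + k \<bar>\<rho>\<bar> * t\<^sup>2)) \<partial>lborel) = \<dots>"
      by (simp only: s_def)
  qed
  also have "\<dots> = ennreal (2 * pi / sqrt (p * m)) * (2 * I)"
    unfolding I_def
    using nn_integral_abs[of "\<lambda>\<rho>. ennreal (exp (- p * breg y (ln \<rho>) / 2 + \<bar>ln \<rho> - y\<bar> / 2) * \<rho>)"]
    by (subst nn_integral_cmult) auto
  also have "\<dots> \<le> ennreal (2 * pi / sqrt (p * m)) * (ennreal 2 * ennreal (8 * exp (p / 2) / p * w * exp (2 * y)))"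
    using I by (intro mult_mono order.refl) auto
  also have "\<dots> = ennreal (32 * pi * exp (p / 2) / (p * sqrt p) * (w * exp (2 * y) / sqrt m))"
    using p w m by (subst ennreal_mult'[symmetric], simp)+ (simp add: real_sqrt_mult field_simps)
  finally show ?thesis .
qed

section \<open>The sector on which the bump is large\<close>

text \<open>Half-opening \<open>1 / sqrt m\<close> in slope, and radii between the level points
  supplied by \<open>breg_widths\<close>; \<open>0 < Re z\<close> selects the side of the
  peak.\<close>

definition sector :: "real \<Rightarrow> real \<Rightarrow> real \<Rightarrow> nat \<Rightarrow> complex set" where
  "sector y a b m = {z. 0 < Re z \<and> \<bar>Im z\<bar> \<le> Re z / sqrt m \<and> exp (y - a) < cmod z \<and> cmod z < exp (y + b)}"

lemma sector_measurable [measurable]: "sector y a b m \<in> sets borel"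
  unfolding sector_def by measurable

lemma emeasure_sector_finite: "emeasure lborel (sector y a b m) < \<infinity>"
proof -
  have "emeasure lborel (sector y a b m) \<le> emeasure lborel (cball (0 :: complex) (exp (y + b)))"
    by (intro emeasure_mono) (auto simp: sector_def)
  also have "\<dots> < \<infinity>" by (simp add: emeasure_cball)
  finally show ?thesis .
qed

lemma measure_sector_ge:
  assumes ab: "0 < a" "a \<le> 1" "0 < b" and m: "m > 0"
  shows "exp (- 2) * ((a + b) * exp (2 * y) / sqrt m) \<le> measure lborel (sector y a b m)"
proof -
  define T where "T = {- 1 / sqrt m .. 1 / sqrt m}"
  define P where "P = {exp (y - a) <..< exp (y + b)}"
  have sm: "sqrt m \<ge> 1" using m by simp
  \<comment> \<open>On this coordinate rectangle the polar density is at least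
    \<open>exp (y - 1) / 2\<close>, because \<open>a \<le> 1\<close> and
    \<open>t ^ 2 \<le> 1\<close>.\<close>
  have "ennreal (exp (y - 1) / 2) * (emeasure lborel P * emeasure lborel T) =
     (\<integral>\<^sup>+t. \<integral>\<^sup>+\<rho>. ennreal (exp (y - 1) / 2) * (indicator T t * indicator P \<rho>) \<partial>lborel \<partial>lborel)"
    by (simp add: nn_integral_cmult nn_integral_multc T_def P_def mult_ac)
  also have "\<dots> \<le> (\<integral>\<^sup>+t. \<integral>\<^sup>+\<rho>. ennreal (\<bar>\<rho>\<bar> / (1 + t\<^sup>2)) *
     indicator (sector y a b m) (Complex (\<rho> / sqrt (1 + t\<^sup>2)) (t * \<rho> / sqrt (1 + t\<^sup>2))) \<partial>lborel \<partial>lborel)"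
  proof (intro nn_integral_mono)
    fix t \<rho> :: real
    let ?z = "Complex (\<rho> / sqrt (1 + t\<^sup>2)) (t * \<rho> / sqrt (1 + t\<^sup>2))"
    show "ennreal (exp (y - 1) / 2) * (indicator T t * indicator P \<rho>) \<le>
       ennreal (\<bar>\<rho>\<bar> / (1 + t\<^sup>2)) * indicator (sector y a b m) ?z"
    proof (cases "t \<in> T \<and> \<rho> \<in> P")
      case True
      then have t: "\<bar>t\<bar> \<le> 1 / sqrt m" and \<rho>: "exp (y - a) < \<rho>" "\<rho> < exp (y + b)"
        by (auto simp: T_def P_def abs_le_iff)
      have \<rho>0: "\<rho> > 0" using \<rho>(1) exp_gt_zero less_trans by blast
      have "\<bar>t\<bar> \<le> 1" using t sm by (meson order.trans divide_le_eq_1_pos less_le_trans zero_less_one)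
      then have t2: "t\<^sup>2 \<le> 1" by (simp add: abs_square_le_1)
      have pos: "sqrt (1 + t\<^sup>2) > 0" using add_pos_nonneg[of 1 "t\<^sup>2"] by simp
      have "\<bar>t\<bar> * (\<rho> / sqrt (1 + t\<^sup>2)) \<le> 1 / sqrt m * (\<rho> / sqrt (1 + t\<^sup>2))"
        using t \<rho>0 pos by (intro mult_right_mono) auto
      then have "?z \<in> sector y a b m"
        using \<rho> \<rho>0 pos polar_point(1)[of \<rho> t] by (simp add: sector_def abs_mult mult_ac)
      moreover have "exp (y - 1) / 2 \<le> \<rho> / (1 + t\<^sup>2)"
      proof (rule frac_le)
        have "exp (y - 1) \<le> exp (y - a)" using ab by simp
        then show "exp (y - 1) \<le> \<rho>" using \<rho> by linarith
        show "0 < 1 + t\<^sup>2" by (simp add: add_pos_nonneg)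
      qed (use t2 \<rho>0 in auto)
      ultimately show ?thesis using True \<rho>0 by (simp add: ennreal_leI)
    qed (auto simp: indicator_def)
  qed
  also have "\<dots> = emeasure lborel (sector y a b m)"
    by (subst nn_integral_polar[symmetric]) auto
  also have "\<dots> = ennreal (measure lborel (sector y a b m))"
    using emeasure_sector_finite by (intro emeasure_eq_ennreal_measure) (simp add: less_top)
  also have "ennreal (exp (y - 1) / 2) * (emeasure lborel P * emeasure lborel T) =
     ennreal (exp (y - 1) / 2 * ((exp (y + b) - exp (y - a)) * (2 / sqrt m)))"
    using ab by (simp add: T_def P_def ennreal_mult'[symmetric])
  finally have le: "exp (y - 1) / 2 * ((exp (y + b) - exp (y - a)) * (2 / sqrt m)) \<le> measure lborel (sector y a b m)"
    by (simp add: ennreal_le_iff)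
  have "exp (y - 1) * (a + b) \<le> exp (y - a) * (exp (a + b) - 1)"
  proof (rule mult_mono)
    show "a + b \<le> exp (a + b) - 1" using exp_ge_add_one_self[of "a + b"] by linarith
  qed (use ab in auto)
  also have "\<dots> = exp (y + b) - exp (y - a)" by (simp add: algebra_simps exp_add[symmetric])
  finally have "exp (y - 1) / 2 * ((exp (y - 1) * (a + b)) * (2 / sqrt m)) \<le>
     exp (y - 1) / 2 * ((exp (y + b) - exp (y - a)) * (2 / sqrt m))"
    by (intro mult_left_mono mult_right_mono) auto
  moreover have "exp (- 2) * ((a + b) * exp (2 * y) / sqrt m) = exp (y - 1) / 2 * ((exp (y - 1) * (a + b)) * (2 / sqrt m))"
  proof -
    have "exp (- 2) * ((a + b) * exp (2 * y) / sqrt m) = (exp (- 2) * exp (2 * y)) * ((a + b) / sqrt m)" by simp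
    also have "exp (- 2) * exp (2 * y) = exp (y - 1) * exp (y - 1)" by (simp add: exp_add[symmetric])
    finally show ?thesis by simp
  qed
  ultimately show ?thesis using le by linarith
qed

text \<open>In the sector the cosine is at least its square, hence at least
  \<open>1 - 1 / m\<close>. The angular factor is then at least \<open>1 - 1 / (2 * m)\<close>, and
  Bernoulli's inequality bounds its \<open>m\<close>-th power below by \<open>1 / 2\<close>.\<close>

lemma norm_bump_ge:
  assumes n: "\<nu> y = real n" "m \<le> n" and m: "m > 0"
    and le: "\<And>x. y - a \<le> x \<Longrightarrow> x \<le> y + b \<Longrightarrow> breg y x \<le> 1"
    and z: "z \<in> sector y a b m"
  shows "exp (- 1) / 2 \<le> cmod (bump y n m z) * exp (- W z)"
proof -
  have Re: "Re z > 0" and Im: "\<bar>Im z\<bar> \<le> Re z / sqrt m" and mod: "exp (y - a) < cmod z" "cmod z < exp (y + b)"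
    using z by (auto simp: sector_def)
  have z0: "z \<noteq> 0" using Re by auto
  then have cz: "cmod z > 0" by simp
  define c where "c = Re z / cmod z"
  have c: "0 < c" "c \<le> 1" using Re cz complex_Re_le_cmod[of z] by (auto simp: c_def)
  have "(Im z)\<^sup>2 \<le> (Re z / sqrt m)\<^sup>2" using power_mono[OF Im, of 2] by simp
  then have "m * (Im z)\<^sup>2 \<le> (Re z)\<^sup>2" using m by (simp add: power_divide field_simps)
  then have "(real m - 1) * (cmod z)\<^sup>2 \<le> m * (Re z)\<^sup>2"
    using zero_le_power2[of "Im z"] unfolding cmod_power2 left_diff_distrib distrib_left by linarith
  then have "1 - 1 / m \<le> c\<^sup>2"
    using m cz by (simp add: c_def power_divide field_simps)
  also have "c\<^sup>2 \<le> c" using c by (simp add: power2_eq_square mult_left_le)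
  finally have c2: "1 - 1 / m \<le> c" .
  define q where "q = (cmod (z + of_real (exp y)))\<^sup>2 / (4 * exp y * cmod z)"
  define h where "h = cosh (ln (cmod z) - y)"
  have "q = (1 + h) / 2 - (1 - c) / 2"
    using bump_ratio[OF z0, of y] by (simp only: q_def c_def h_def)
  moreover have "h \<ge> 1" unfolding h_def by (rule cosh_real_ge_1)
  ultimately have "1 - (1 / m) / 2 \<le> q" using c2 by (simp add: field_simps)
  then have "1 + (- 1 / (2 * m)) \<le> q" by simp
  then have "(1 + (- 1 / (2 * m))) ^ m \<le> q ^ m" using m by (intro power_mono) (auto simp: field_simps)
  moreover have "1 + m * (- 1 / (2 * m)) \<le> (1 + (- 1 / (2 * m))) ^ m"
    using m by (intro Bernoulli_inequality) (auto simp: field_simps)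
  ultimately have q: "1 / 2 \<le> q ^ m" using m by simp
  have "y - a < ln (cmod z)" "ln (cmod z) < y + b"
    using mod cz by (metis exp_ln exp_less_cancel_iff)+
  then have "exp (- 1) \<le> exp (- breg y (ln (cmod z)))" using le by simp
  then have "exp (- 1) * (1 / 2) \<le> exp (- breg y (ln (cmod z))) * q ^ m"
    using q by (intro mult_mono) auto
  then show ?thesis using norm_bump[OF n z0] by (simp add: q_def)
qed

text \<open>The logarithmic derivative times \<open>z\<close> is
  \<open>n - m + 2 * m * z / (z + r)\<close>. In the right half-plane the second term has
  nonnegative real part, so it cannot cancel the first.\<close>

lemma norm_deriv_bump_ge:
  assumes m: "m \<le> n" and Re: "Re z > 0"
  shows "(real n - m) / cmod z * cmod (bump y n m z) \<le> cmod (deriv (bump y n m) z)"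
proof -
  define r where "r = complex_of_real (exp y)"
  define C where "C = complex_of_real (exp (\<phi> y - n * y) / (4 * exp y) ^ m)"
  have z0: "z \<noteq> 0" using Re by auto
  have zr: "z + r \<noteq> 0"
  proof
    assume "z + r = 0"
    then have "Re z + exp y = 0" by (metis Re_complex_of_real plus_complex.sel(1) r_def zero_complex.sel(1))
    then show False using Re exp_gt_zero[of y] by linarith
  qed
  have pw: "of_nat k * w ^ (k - 1) = of_nat k * (w ^ k / w)" if "w \<noteq> 0" for k and w :: complex
    using that by (cases k) auto
  have gen: "C * (N * (u / z)) * v + C * u * (M * (v / w)) = C * u * v * ((N + M * (z / w)) / z)"
    if "w \<noteq> 0" for N M u v w
    using z0 that by (simp add: field_simps)
  have "((\<lambda>z. C * z ^ (n - m) * (z + r) ^ (2 * m)) has_field_derivative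
      C * (of_nat (n - m) * z ^ (n - m - 1)) * (z + r) ^ (2 * m) +
      C * z ^ (n - m) * (of_nat (2 * m) * (z + r) ^ (2 * m - 1))) (at z)"
    by (auto intro!: derivative_eq_intros simp: algebra_simps)
  then have "deriv (bump y n m) z = C * (of_nat (n - m) * z ^ (n - m - 1)) * (z + r) ^ (2 * m) +
      C * z ^ (n - m) * (of_nat (2 * m) * (z + r) ^ (2 * m - 1))"
    unfolding bump_def[abs_def] C_def r_def by (rule DERIV_imp_deriv)
  also have "\<dots> = bump y n m z * ((of_nat (n - m) + of_nat (2 * m) * (z / (z + r))) / z)"
    unfolding pw[OF z0] pw[OF zr] gen[OF zr] by (simp only: bump_def C_def r_def)
  finally have eq: "cmod (deriv (bump y n m) z) =
     cmod (bump y n m z) * (cmod (of_nat (n - m) + of_nat (2 * m) * (z / (z + r))) / cmod z)"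
    by (simp add: norm_mult norm_divide)
  have "Re (z / (z + r)) \<ge> 0"
    using Re by (simp add: Re_divide r_def)
  then have "0 \<le> real (2 * m) * Re (z / (z + r))" by (intro mult_nonneg_nonneg) auto
  moreover have "Re (of_nat k + of_nat l * w) = real k + real l * Re w" for k l w by simp
  ultimately have "real n - m \<le> Re (of_nat (n - m) + of_nat (2 * m) * (z / (z + r)))"
    using of_nat_diff[OF m, where 'a = real] by (simp only:)
  also have "\<dots> \<le> cmod (of_nat (n - m) + of_nat (2 * m) * (z / (z + r)))" by (rule complex_Re_le_cmod)
  finally have "cmod (bump y n m z) * ((real n - m) / cmod z) \<le>
      cmod (bump y n m z) * (cmod (of_nat (n - m) + of_nat (2 * m) * (z / (z + r))) / cmod z)"
    by (intro mult_left_mono divide_right_mono) auto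
  then show ?thesis by (simp add: eq mult.commute)
qed

section \<open>Conclusion for \<open>p \<le> q\<close>\<close>

lemma not_fock_bounded_le:
  assumes p: "0 < p" and pq: "p \<le> q"
  shows "\<not> fock_bounded p q W deriv"
proof -
  \<comment> \<open>For \<open>p = \<infinity>\<close> no integral has to be estimated, and 1 is a
    placeholder.\<close>
  define P where "P = (if p = \<infinity> then 1 else enn2real p)"
  have P: "P > 0" using p by (auto simp: P_def enn2real_positive_iff less_top)
  define K0 where "K0 = 32 * pi * exp (P / 2) / (P * sqrt P)"
  define K where "K = max 1 (max K0 (8 / \<kappa>))"
  have K: "K \<ge> 1" "K \<ge> K0" "K \<ge> 8 / \<kappa>" by (auto simp: K_def)
  obtain X1 where X1: "X1 \<ge> X0" "\<And>x. x \<ge> X1 \<Longrightarrow> c0 / 4 * exp (2 * x) \<le> \<nu> x" using \<nu>_ge by blast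
  show ?thesis
  proof (rule fock_unboundedI[where K = K and c = "exp (- 2)"])
    show "0 < q" using p pq by (rule less_le_trans)
    fix L :: real
    have "\<forall>\<^sub>F y in at_top. X0 + 1 \<le> y \<and> X1 \<le> y \<and> 8 \<le> \<kappa> * exp (2 * y) \<and> (20 / P)\<^sup>2 \<le> \<kappa> * exp (2 * y)
       \<and> L \<le> c0 / 16 * exp (y - 2)"
    proof -
      have 1: "\<forall>\<^sub>F y in at_top. s \<le> \<kappa> * exp (2 * y)" for s
        using eventually_le_exp[of \<kappa> 2 s 0] \<kappa>_pos by simp
      have 2: "\<forall>\<^sub>F y in at_top. L \<le> c0 / 16 * exp (y - 2)"
        using eventually_le_exp[of "c0 / 16" 1 L "- 2"] c0 by simp
      show ?thesis by (intro eventually_conj eventually_ge_at_top 1 2)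
    qed
    \<comment> \<open>With \<open>E = \<kappa> * exp (2 * y)\<close>, the bound 8 makes
      \<open>m\<close> positive, and \<open>(20 / P) ^ 2\<close> brings the width
      \<open>a + b\<close>, at most \<open>2 / sqrt E\<close>, below \<open>P / 10\<close>.\<close>
    then obtain Y where Y: "\<And>y. y \<ge> Y \<Longrightarrow> X0 + 1 \<le> y \<and> X1 \<le> y \<and> 8 \<le> \<kappa> * exp (2 * y)
       \<and> (20 / P)\<^sup>2 \<le> \<kappa> * exp (2 * y) \<and> L \<le> c0 / 16 * exp (y - 2)"
      by (auto simp: eventually_at_top_linorder)
    define n where "n = nat \<lceil>\<nu> Y\<rceil>"
    have "\<nu> Y \<le> real n" unfolding n_def by linarith
    then obtain y where "y \<ge> Y" and ny: "\<nu> y = real n" using \<nu>_surj by blast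
    then have y: "X0 + 1 \<le> y" "X1 \<le> y" and y8: "8 \<le> \<kappa> * exp (2 * y)"
      and yP: "(20 / P)\<^sup>2 \<le> \<kappa> * exp (2 * y)" and yL: "L \<le> c0 / 16 * exp (y - 2)" using Y by auto
    define E where "E = \<kappa> * exp (2 * y)"
    have E: "E \<ge> 8" "(20 / P)\<^sup>2 \<le> E" using y8 yP by (auto simp: E_def)
    \<comment> \<open>\<open>E / 4\<close> respects the limit \<open>2 * m \<le> E\<close> of
      \<open>norm_bump_le\<close> and, by \<open>E \<le> 2 * n\<close>, keeps \<open>m\<close> below
      \<open>n / 2\<close>, so that \<open>n - m\<close> is still of order \<open>n\<close>.\<close>
    define m where "m = nat \<lfloor>E / 4\<rfloor>"
    have m: "real m \<le> E / 4" "E / 8 \<le> real m" "m > 0" using E unfolding m_def by linarith+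
    have "E = c0 / 2 * exp (2 * y) * exp (- 2)" by (simp add: E_def \<kappa>_def)
    also have "\<dots> \<le> c0 / 2 * exp (2 * y) * 1" using c0 by (intro mult_left_mono) auto
    finally have En: "E \<le> 2 * real n" using X1(2)[OF y(2)] ny by simp
    then have mn: "m \<le> n" "real n / 2 \<le> real n - m" using m by (linarith+)
    obtain a b where a: "0 < a" "a \<le> 1 / sqrt E" and b: "0 < b" "b \<le> 1 / sqrt E"
      and le1: "\<And>x. y - a \<le> x \<Longrightarrow> x \<le> y + b \<Longrightarrow> breg y x \<le> 1"
      and B: "\<And>x. \<bar>x - y\<bar> / (a + b) - 1 \<le> breg y x"
    proof -
      have "1 \<le> \<kappa> * exp (2 * y)" using y8 by linarith
      from breg_widths[OF y(1) this, folded E_def] that show ?thesis by blast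
    qed
    have sE: "sqrt E \<ge> 1" "20 / P \<le> sqrt E" using E P by (auto intro: real_le_rsqrt)
    have isE: "1 / sqrt E \<le> 1" using sE by simp
    have a1: "a \<le> 1" "b \<le> 1" using a b isE by linarith+
    have "20 * (1 / sqrt E) \<le> P" using sE P by (simp add: field_simps)
    moreover have "10 * (a + b) \<le> 10 * (1 / sqrt E + 1 / sqrt E)"
      using a b by (intro mult_left_mono add_mono) auto
    ultimately have w: "0 < a + b" "10 * (a + b) \<le> P" using a b by simp_all
    define A where "A = (a + b) * exp (2 * y) / sqrt m"
    have A0: "A > 0" using w m by (simp add: A_def)
    have "A \<le> 8 / \<kappa>"
    proof -
      \<comment> \<open>\<open>E / 8\<close> is lowered to \<open>E / 9\<close> for the sake of a
        rational square root.\<close>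
      have "sqrt (E / 9) \<le> sqrt m" using m E by (intro real_sqrt_le_mono) linarith
      then have sm: "sqrt E / 3 \<le> sqrt m" by (simp add: real_sqrt_divide)
      have "sqrt E / 4 \<le> sqrt m" using sm sE by linarith
      then have "A \<le> (2 / sqrt E) * exp (2 * y) / (sqrt E / 4)"
        unfolding A_def using a b sE w by (intro frac_le mult_right_mono) auto
      also have "\<dots> = 8 * exp (2 * y) / (sqrt E * sqrt E)" by simp
      also have "sqrt E * sqrt E = E" using E by simp
      also have "8 * exp (2 * y) / E = 8 / \<kappa>" by (simp add: E_def)
      finally show ?thesis .
    qed
    then have AK: "A \<le> K" using K by linarith
    have hol: "bump y n m holomorphic_on UNIV"
      unfolding bump_def[abs_def] by (intro holomorphic_intros)
    have nonpos: "- v / 2 - t \<le> 0" if "v \<ge> 0" "t \<ge> 0" for v t :: real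
      using that by simp
    have b0: "bump y n m 0 = 0" using mn m by (simp add: bump_def)
    show "\<exists>f E A. f holomorphic_on UNIV \<and> (\<forall>z. cmod (f z) * exp (- W z) \<le> K) \<and>
      E \<in> sets lborel \<and> emeasure lborel E < \<infinity> \<and> 0 < A \<and> exp (- 2) * A \<le> measure lborel E \<and>
      (\<forall>z\<in>E. L \<le> cmod (deriv f z) * exp (- W z)) \<and>
      (p \<noteq> \<infinity> \<longrightarrow> (\<integral>\<^sup>+z. ennreal ((cmod (f z) * exp (- W z)) powr enn2real p) \<partial>lborel) \<le> ennreal (K * A)) \<and>
      (p \<le> q \<and> A \<le> K \<or> q \<le> p \<and> exp (- 2) \<le> A)"
    proof (intro exI[of _ "bump y n m"] exI[of _ "sector y a b m"] exI[of _ A] conjI allI impI ballI)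
      fix z :: complex
      show "cmod (bump y n m z) * exp (- W z) \<le> K"
      proof (cases "z = 0")
        case True
        then show ?thesis using b0 K by simp
      next
        case False
        have "cmod (bump y n m z) * exp (- W z) \<le>
          exp (- breg y (ln (cmod z)) / 2 - m * exp (- \<bar>ln (cmod z) - y\<bar>) / 4 * (Im z / cmod z)\<^sup>2)"
          using y ny mn m False by (intro norm_bump_le) (auto simp: E_def)
        also have "\<dots> \<le> 1"
          unfolding exp_le_one_iff
          by (intro nonpos breg_nonneg mult_nonneg_nonneg divide_nonneg_nonneg) auto
        finally show ?thesis using K by linarith
      qed
    next
      show "exp (- 2) * A \<le> measure lborel (sector y a b m)"
        unfolding A_def using a a1 b m by (intro measure_sector_ge) auto
    next
      fix z assume z: "z \<in> sector y a b m"
      then have Re: "Re z > 0" and mod: "cmod z < exp (y + b)" by (auto simp: sector_def)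
      have cz: "cmod z > 0" using Re by auto
      have "cmod z \<le> exp (y + 1)" using mod a1 by (meson add_left_mono exp_le_cancel_iff less_imp_le order.trans)
      have "L \<le> c0 / 16 * exp (y - 2)" by (rule yL)
      \<comment> \<open>The three factors: \<open>n - m \<ge> n / 2\<close>, the modulus at most
        \<open>exp (y + 1)\<close>, and the weighted bump at least
        \<open>exp (- 1) / 2\<close>.\<close>
      also have "\<dots> = c0 / 8 * exp (2 * y) / exp (y + 1) * (exp (- 1) / 2)"
      proof -
        have "exp (y - 2) = exp (2 * y - (y + 1) + - 1)" by simp
        also have "\<dots> = exp (2 * y) / exp (y + 1) * exp (- 1)" by (simp only: exp_diff exp_add)
        finally show ?thesis by simp
      qed
      also have "\<dots> \<le> (real n - m) / cmod z * (exp (- 1) / 2)"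
      proof (intro mult_right_mono frac_le)
        show "c0 / 8 * exp (2 * y) \<le> real n - m" using X1(2)[OF y(2)] ny mn(2) by simp
      qed (use cz \<open>cmod z \<le> exp (y + 1)\<close> mn in auto)
      also have "\<dots> \<le> (real n - m) / cmod z * (cmod (bump y n m z) * exp (- W z))"
        using norm_bump_ge[OF ny mn(1) m(3) le1 z] mn by (intro mult_left_mono) auto
      also have "\<dots> \<le> cmod (deriv (bump y n m) z) * exp (- W z)"
        unfolding mult.assoc[symmetric] using norm_deriv_bump_ge[OF mn(1) Re, of y] by (intro mult_right_mono) auto
      finally show "L \<le> cmod (deriv (bump y n m) z) * exp (- W z)" .
    next
      assume "p \<noteq> \<infinity>"
      then have "(\<integral>\<^sup>+z. ennreal ((cmod (bump y n m z) * exp (- W z)) powr enn2real p) \<partial>lborel) \<le> ennreal (K0 * A)"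
        unfolding K0_def A_def using nn_integral_bump_le[OF y(1) ny mn(1) _ m(3) P w B] m
        by (simp add: P_def E_def)
      also have "\<dots> \<le> ennreal (K * A)" using K A0 by (intro ennreal_leI mult_right_mono) auto
      finally show "(\<integral>\<^sup>+z. ennreal ((cmod (bump y n m z) * exp (- W z)) powr enn2real p) \<partial>lborel) \<le> ennreal (K * A)" .
    qed (use hol A0 AK pq emeasure_sector_finite in auto)
  qed (use p K W_measurable in auto)
qed

end

section \<open>Sums of separated peaks\<close>

lemma measure_annulus:
  fixes a b :: real
  assumes "0 \<le> a" "a \<le> b"
  shows "measure lborel {z :: complex. a \<le> cmod z \<and> cmod z \<le> b} = pi * (b\<^sup>2 - a\<^sup>2)"
proof -
  have "{z :: complex. a \<le> cmod z \<and> cmod z \<le> b} = cball 0 b - ball 0 a"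
    by auto
  also have "measure lborel \<dots> = measure lborel (cball (0 :: complex) b) - measure lborel (ball (0 :: complex) a)"
    using assms by (intro measure_Diff) (auto simp: emeasure_cball)
  also have "\<dots> = pi * (b\<^sup>2 - a\<^sup>2)"
    using assms by (simp add: content_cball content_ball unit_ball_vol_2 right_diff_distrib)
  finally show ?thesis .
qed

lemma annulus_fmeasurable: "{z :: complex. a \<le> cmod z \<and> cmod z \<le> b} \<in> fmeasurable lborel"
proof -
  have "emeasure lborel {z :: complex. a \<le> cmod z \<and> cmod z \<le> b} \<le> emeasure lborel (cball (0::complex) b)"
    by (intro emeasure_mono) auto
  also have "\<dots> < \<infinity>" by (cases "b \<ge> 0") (auto simp: emeasure_cball)
  finally show ?thesis by (simp add: fmeasurable_def)
qed

text \<open>Separation makes each peak at most \<open>exp (- 32)\<close> at the centres next to it,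
  while \<open>cover\<close> excludes a stretch where all peaks are small. The level 33 exceeds 32
  because exponents can only be raised in integer steps. The bound in \<open>gap\<close> limits the
  distortion between logarithmic length and area.\<close>

locale peak_sequence = log_convex_weight +
  fixes xs :: "nat \<Rightarrow> real" and ns :: "nat \<Rightarrow> nat"
  assumes \<nu>_xs: "\<nu> (xs k) = real (ns k)"
    and ns_less: "ns k < ns (Suc k)"
    and ns_pos: "0 < ns 0"
    and sepR: "32 \<le> breg (xs k) (xs (Suc k))"
    and sepL: "32 \<le> breg (xs (Suc k)) (xs k)"
    and gap: "xs (Suc k) \<le> xs k + 1"
    and cover: "xs k \<le> x \<Longrightarrow> x \<le> xs (Suc k) \<Longrightarrow> breg (xs k) x \<le> 33 \<or> breg (xs (Suc k)) x \<le> 33"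
begin

lemma xs_less: "xs k < xs (Suc k)"
proof (rule ccontr)
  assume "\<not> ?thesis"
  then have "\<nu> (xs (Suc k)) \<le> \<nu> (xs k)" by (intro \<nu>_mono) simp
  then show False using ns_less[of k] by (simp add: \<nu>_xs)
qed

lemma xs_mono: "j \<le> k \<Longrightarrow> xs j \<le> xs k"
  by (rule lift_Suc_mono_le[of xs]) (use xs_less less_imp_le in blast)+

lemma ns_mono: "j \<le> k \<Longrightarrow> ns j \<le> ns k"
  by (rule lift_Suc_mono_le[of ns]) (use ns_less less_imp_le in blast)+

definition h :: "nat \<Rightarrow> real \<Rightarrow> real" where
  "h k x = exp (- breg (xs k) x)"

lemma h_pos: "h k x > 0" and h_le_1: "h k x \<le> 1"
  using breg_nonneg by (auto simp: h_def)

lemma exp_32: "exp (- 32 :: real) \<le> 1 / 33"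
proof -
  have "(33 :: real) \<le> exp 32" using exp_ge_add_one_self[of "32 :: real"] by simp
  then show ?thesis by (simp add: exp_minus field_simps)
qed

text \<open>The exponents of two neighbouring peaks differ by an affine function with positive
  slope, so the ratio \<open>exp (- 32)\<close> at the centre of the right one only improves further
  to the right.\<close>

lemma h_stepR:
  assumes "xs (Suc k) \<le> x"
  shows "h k x \<le> h (Suc k) x / 33"
proof -
  have "0 \<le> (\<nu> (xs (Suc k)) - \<nu> (xs k)) * (x - xs (Suc k))"
    using assms ns_less[of k] by (intro mult_nonneg_nonneg) (auto simp: \<nu>_xs)
  then have "breg (xs (Suc k)) x + 32 \<le> breg (xs k) x"
    using breg_three_point[of "xs k" x "xs (Suc k)"] sepR[of k] by linarith
  then have "h k x \<le> h (Suc k) x * exp (- 32)" by (simp add: h_def exp_add[symmetric])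
  also have "\<dots> \<le> h (Suc k) x * (1 / 33)" using exp_32 h_pos by (intro mult_left_mono) (auto intro: less_imp_le)
  finally show ?thesis by simp
qed

lemma h_stepL:
  assumes "x \<le> xs k"
  shows "h (Suc k) x \<le> h k x / 33"
proof -
  have "0 \<le> (\<nu> (xs k) - \<nu> (xs (Suc k))) * (x - xs k)"
    using assms ns_less[of k] by (intro mult_nonpos_nonpos) (auto simp: \<nu>_xs)
  then have "breg (xs k) x + 32 \<le> breg (xs (Suc k)) x"
    using breg_three_point[of "xs (Suc k)" x "xs k"] sepL[of k] by linarith
  then have "h (Suc k) x \<le> h k x * exp (- 32)" by (simp add: h_def exp_add[symmetric])
  also have "\<dots> \<le> h k x * (1 / 33)" using exp_32 h_pos by (intro mult_left_mono) (auto intro: less_imp_le)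
  finally show ?thesis by simp
qed

text \<open>A geometric sum: the induction closes because
  \<open>(1 + 1 / 16) / 33 \<le> 1 / 16\<close>.\<close>

lemma sum_h_below: "xs k \<le> x \<Longrightarrow> (\<Sum>j<k. h j x) \<le> h k x / 16"
proof (induction k)
  case 0
  then show ?case using h_pos[of 0 x] by simp
next
  case (Suc k)
  then have "xs k \<le> x" using xs_less[of k] by simp
  then show ?case using Suc.IH h_stepR[OF Suc.prems] h_pos[of "Suc k" x] by simp
qed

lemma sum_h_above:
  assumes "k \<le> J" "x \<le> xs k"
  shows "(\<Sum>j\<in>{k<..J}. h j x) \<le> h k x / 16"
  using assms
proof (induction rule: inc_induct)
  case base
  then show ?case using h_pos[of J x] by simp
next
  case (step k)
  have "x \<le> xs (Suc k)" using step.prems xs_less[of k] by simp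
  note IH = step.IH[OF this]
  have "{k<..J} = insert (Suc k) {Suc k<..J}" using step.hyps by auto
  then have "(\<Sum>j\<in>{k<..J}. h j x) = h (Suc k) x + (\<Sum>j\<in>{Suc k<..J}. h j x)" by simp
  then show ?case using IH h_stepL[OF step.prems] h_pos[of k x] by simp
qed

lemma sum_h_le_left:
  assumes "x \<le> xs 0"
  shows "(\<Sum>j\<le>J. h j x) \<le> 3 * h 0 x"
proof -
  have "{..J} = insert 0 {0<..J}" by auto
  then have "(\<Sum>j\<le>J. h j x) = h 0 x + (\<Sum>j\<in>{0<..J}. h j x)" by simp
  then show ?thesis using sum_h_above[of 0 J x] assms h_pos[of 0 x] by simp
qed

lemma sum_h_le_right:
  assumes "xs J \<le> x"
  shows "(\<Sum>j\<le>J. h j x) \<le> 3 * h J x"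
  using sum_h_below[OF assms] h_pos[of J x] by (simp add: lessThan_Suc_atMost[symmetric])

lemma sum_split:
  fixes g :: "nat \<Rightarrow> 'b :: comm_monoid_add"
  assumes "k < J"
  shows "(\<Sum>j\<le>J. g j) = (\<Sum>j<k. g j) + g k + g (Suc k) + (\<Sum>j\<in>{Suc k<..J}. g j)"
proof -
  have "{..J} = {..<k} \<union> {k} \<union> {Suc k} \<union> {Suc k<..J}" using assms by auto
  moreover have "sum g ({..<k} \<union> {k} \<union> {Suc k} \<union> {Suc k<..J}) =
      sum g ({..<k} \<union> {k} \<union> {Suc k}) + sum g {Suc k<..J}"
    by (rule sum.union_disjoint) auto
  ultimately show ?thesis by (simp add: add_ac)
qed

lemma between:
  assumes "xs 0 \<le> x" "x \<le> xs J" "0 < J"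
  obtains k where "k < J" "xs k \<le> x" "x \<le> xs (Suc k)"
proof -
  have "\<exists>k<J. xs k \<le> x \<and> x \<le> xs (Suc k)"
    using assms(2,3)
  proof (induction J)
    case (Suc J)
    show ?case
    proof (cases "xs J \<le> x")
      case False
      then have "J > 0" using assms(1) by (cases J) auto
      with Suc.IH False show ?thesis by (meson less_SucI linear)
    qed (use Suc in auto)
  qed simp
  then show ?thesis using that by blast
qed

lemma sum_h_le: "0 < J \<Longrightarrow> (\<Sum>j\<le>J. h j x) \<le> 3"
proof -
  assume J: "0 < J"
  consider "x \<le> xs 0" | "xs J \<le> x" | "xs 0 \<le> x" "x \<le> xs J" by linarith
  then show ?thesis
  proof cases
    case 1
    then show ?thesis using sum_h_le_left[OF 1, of J] h_le_1[of 0 x] by simp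
  next
    case 2
    then show ?thesis using sum_h_le_right[OF 2] h_le_1[of J x] by simp
  next
    case 3
    then obtain k where k: "k < J" "xs k \<le> x" "x \<le> xs (Suc k)" using between J by blast
    show ?thesis
      using sum_h_below[OF k(2)] sum_h_above[of "Suc k" J x] k h_le_1[of k x] h_le_1[of "Suc k" x]
      by (simp add: sum_split[OF k(1)])
  qed
qed

text \<open>The factor \<open>ns 0 / ns k\<close> makes the peaks of the derivative equally high, so that the neighbours
  of a dominant term stay negligible there, whatever the growth of \<open>ns\<close>.\<close>

definition comb :: "nat \<Rightarrow> complex \<Rightarrow> complex" where
  "comb J z = (\<Sum>k\<le>J. of_real (ns 0 / ns k * exp (\<phi> (xs k) - ns k * xs k)) * z ^ ns k)"

lemma ns_gt_0: "0 < ns k"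
  using ns_pos ns_mono[of 0 k] by linarith

lemma norm_term:
  assumes z: "z \<noteq> 0"
  shows "exp (\<phi> (xs k) - ns k * xs k) * cmod z ^ ns k * exp (- W z) = h k (ln (cmod z))"
proof -
  have "cmod z ^ ns k = exp (ns k * ln (cmod z))" using z by (simp add: exp_of_nat_mult)
  then show ?thesis using z
    by (simp add: W_eq h_def breg_def \<nu>_xs exp_add[symmetric] algebra_simps)
qed

lemma norm_comb_le:
  assumes z: "z \<noteq> 0"
  shows "cmod (comb J z) * exp (- W z) \<le> (\<Sum>k\<le>J. h k (ln (cmod z)))"
proof -
  have "cmod (comb J z) \<le> (\<Sum>k\<le>J. cmod (of_real (ns 0 / ns k * exp (\<phi> (xs k) - ns k * xs k)) * z ^ ns k))"
    unfolding comb_def by (rule norm_sum)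
  also have "\<dots> \<le> (\<Sum>k\<le>J. exp (\<phi> (xs k) - ns k * xs k) * cmod z ^ ns k)"
  proof (intro sum_mono)
    fix k
    have "real (ns 0) / real (ns k) \<le> 1" using ns_mono[of 0 k] ns_gt_0[of k] by simp
    then have "real (ns 0) / real (ns k) * (exp (\<phi> (xs k) - ns k * xs k) * cmod z ^ ns k) \<le> 1 * (exp (\<phi> (xs k) - ns k * xs k) * cmod z ^ ns k)"
      by (intro mult_right_mono) auto
    then show "cmod (of_real (ns 0 / ns k * exp (\<phi> (xs k) - ns k * xs k)) * z ^ ns k) \<le> exp (\<phi> (xs k) - ns k * xs k) * cmod z ^ ns k"
      by (simp add: norm_mult norm_power norm_divide abs_mult mult.assoc)
  qed
  finally have "cmod (comb J z) * exp (- W z) \<le> (\<Sum>k\<le>J. exp (\<phi> (xs k) - ns k * xs k) * cmod z ^ ns k) * exp (- W z)"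
    by (intro mult_right_mono) auto
  also have "\<dots> = (\<Sum>k\<le>J. h k (ln (cmod z)))"
    by (simp add: sum_distrib_right norm_term[OF z])
  finally show ?thesis .
qed

lemma deriv_comb:
  assumes z: "z \<noteq> 0"
  shows "deriv (comb J) z * z = of_nat (ns 0) * (\<Sum>k\<le>J. of_real (exp (\<phi> (xs k) - ns k * xs k)) * z ^ ns k)"
proof -
  have "(comb J has_field_derivative
     (\<Sum>k\<le>J. of_real (ns 0 / ns k * exp (\<phi> (xs k) - ns k * xs k)) * (of_nat (ns k) * z ^ (ns k - 1)))) (at z)"
    unfolding comb_def[abs_def]
    by (intro DERIV_sum DERIV_cmult) (auto intro!: derivative_eq_intros)
  then have "deriv (comb J) z * z =
     (\<Sum>k\<le>J. of_real (ns 0 / ns k * exp (\<phi> (xs k) - ns k * xs k)) * (of_nat (ns k) * z ^ (ns k - 1))) * z"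
    by (simp add: DERIV_imp_deriv)
  also have "\<dots> = (\<Sum>k\<le>J. of_nat (ns 0) * (of_real (exp (\<phi> (xs k) - ns k * xs k)) * z ^ ns k))"
    unfolding sum_distrib_right
  proof (intro sum.cong refl)
    fix k
    have "z ^ (ns k - 1) * z = z ^ ns k" using ns_gt_0[of k] by (rule power_minus_mult)
    moreover have "of_nat (ns k) \<noteq> (0 :: complex)" using ns_gt_0[of k] by simp
    ultimately show "of_real (ns 0 / ns k * exp (\<phi> (xs k) - ns k * xs k)) * (of_nat (ns k) * z ^ (ns k - 1)) * z
      = of_nat (ns 0) * (of_real (exp (\<phi> (xs k) - ns k * xs k)) * z ^ ns k)"
      by (simp add: field_simps)
  qed
  finally show ?thesis by (simp add: sum_distrib_left)
qed

text \<open>By \<open>cover\<close> the larger neighbour is at least \<open>exp (- 33)\<close>. The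
  other is at most a third of it, since \<open>exp (- 2) \<le> 1 / 3\<close>, and the remaining
  terms are at most a sixteenth of each neighbour: \<open>1 - 1 / 3 - 1 / 16 - 1 / 48\<close>
  exceeds \<open>1 / 2\<close>.\<close>

lemma norm_sum_dominated:
  fixes g :: "nat \<Rightarrow> complex"
  assumes k: "k < J" and x: "xs k \<le> x" "x \<le> xs (Suc k)"
    and g: "\<And>j. cmod (g j) = h j x"
    and D: "2 \<le> \<bar>breg (xs k) x - breg (xs (Suc k)) x\<bar>"
  shows "exp (- 33) / 2 \<le> cmod (\<Sum>j\<le>J. g j)"
proof -
  define a where "a = (\<Sum>j<k. g j)"
  define b where "b = (\<Sum>j\<in>{Suc k<..J}. g j)"
  have split: "(\<Sum>j\<le>J. g j) = a + g k + g (Suc k) + b"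
    unfolding a_def b_def by (rule sum_split[OF k])
  have a: "cmod a \<le> h k x / 16"
    using norm_sum[of g "{..<k}"] sum_h_below[OF x(1)] by (simp add: a_def g)
  have b: "cmod b \<le> h (Suc k) x / 16"
    using norm_sum[of g "{Suc k<..J}"] sum_h_above[of "Suc k" J x] x k by (simp add: b_def g)
  have e2: "exp (- 2 :: real) \<le> 1 / 3"
    using exp_ge_add_one_self[of "2 :: real"] by (simp add: exp_minus field_simps)
  have cov: "exp (- 33) \<le> h k x \<or> exp (- 33) \<le> h (Suc k) x"
    using cover[OF x] by (auto simp: h_def)
  have rel: "h i x \<le> h j x / 3" if "breg (xs j) x + 2 \<le> breg (xs i) x" for i j
  proof -
    have "h i x \<le> h j x * exp (- 2)" using that by (simp add: h_def exp_add[symmetric])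
    also have "\<dots> \<le> h j x * (1 / 3)" using e2 h_pos by (intro mult_left_mono) (auto intro: less_imp_le)
    finally show ?thesis by simp
  qed
  have tri: "cmod v \<le> cmod (a + u + v + b) + cmod a + cmod u + cmod b"
    "cmod u \<le> cmod (a + u + v + b) + cmod a + cmod v + cmod b" for u v
    using norm_triangle_ineq4[of "a + u + v + b" "a + u + b"] norm_triangle_ineq4[of "a + u + v + b" "a + v + b"]
      norm_triangle_ineq[of "a + u" b] norm_triangle_ineq[of a u] norm_triangle_ineq[of "a + v" b] norm_triangle_ineq[of a v]
    by (simp_all add: algebra_simps)
  note t = tri[where u = "g k" and v = "g (Suc k)", unfolded g, folded split]
  consider "breg (xs k) x + 2 \<le> breg (xs (Suc k)) x" | "breg (xs (Suc k)) x + 2 \<le> breg (xs k) x"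
    using D by linarith
  then show ?thesis
  proof cases
    case 1
    show ?thesis using rel[OF 1] cov t(2) a b h_pos[of k x] h_pos[of "Suc k" x] by linarith
  next
    case 2
    show ?thesis using rel[OF 2] cov t(1) a b h_pos[of k x] h_pos[of "Suc k" x] by linarith
  qed
qed

text \<open>Only near the crossing point of two neighbouring peaks can cancellation occur. As the difference of
  the two exponents is affine with slope \<open>ns (Suc k) - ns k\<close>, the separation condition makes that zone
  a small part of the interval.\<close>

definition good :: "nat \<Rightarrow> complex set" where
  "good J = {z. z \<noteq> 0 \<and> (\<exists>k<J. xs k \<le> ln (cmod z) \<and> ln (cmod z) \<le> xs (Suc k) \<and>
     2 \<le> \<bar>breg (xs k) (ln (cmod z)) - breg (xs (Suc k)) (ln (cmod z))\<bar>)}"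

definition bad :: "nat \<Rightarrow> complex set" where
  "bad k = {z. z \<noteq> 0 \<and> xs k \<le> ln (cmod z) \<and> ln (cmod z) \<le> xs (Suc k) \<and>
     \<bar>breg (xs k) (ln (cmod z)) - breg (xs (Suc k)) (ln (cmod z))\<bar> < 2}"

lemma good_measurable [measurable]: "good J \<in> sets borel"
  unfolding good_def by measurable

lemma bad_measurable [measurable]: "bad k \<in> sets borel"
  unfolding bad_def by measurable

lemma ln_le_cmod: "z \<noteq> 0 \<Longrightarrow> x \<le> ln (cmod z) \<longleftrightarrow> exp x \<le> cmod z"
  and ln_ge_cmod: "z \<noteq> 0 \<Longrightarrow> ln (cmod z) \<le> x \<longleftrightarrow> cmod z \<le> exp x"
  by (metis exp_le_cancel_iff exp_ln zero_less_norm_iff)+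

lemma norm_deriv_comb_ge:
  assumes z: "z \<in> good J"
  shows "real (ns 0) * exp (- 33) / 2 / exp (xs J) \<le> cmod (deriv (comb J) z) * exp (- W z)"
proof -
  obtain k where z0: "z \<noteq> 0" and k: "k < J" "xs k \<le> ln (cmod z)" "ln (cmod z) \<le> xs (Suc k)"
     "2 \<le> \<bar>breg (xs k) (ln (cmod z)) - breg (xs (Suc k)) (ln (cmod z))\<bar>"
    using z by (auto simp: good_def)
  define g where "g = (\<lambda>k. of_real (exp (\<phi> (xs k) - ns k * xs k)) * z ^ ns k * of_real (exp (- W z)))"
  have "cmod (g j) = h j (ln (cmod z))" for j
    using norm_term[OF z0, of j] by (simp add: g_def norm_mult norm_power)
  from norm_sum_dominated[where g = g, OF k(1-3) this k(4)]
  have "exp (- 33) / 2 \<le> cmod (\<Sum>j\<le>J. g j)" .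
  then have "real (ns 0) * (exp (- 33) / 2) \<le> real (ns 0) * cmod (\<Sum>j\<le>J. g j)" by (intro mult_left_mono) auto
  also have "\<dots> = cmod (deriv (comb J) z * z) * exp (- W z)"
    by (simp add: deriv_comb[OF z0] g_def sum_distrib_right[symmetric] norm_mult)
  finally have "real (ns 0) * exp (- 33) / 2 \<le> (cmod (deriv (comb J) z) * exp (- W z)) * cmod z"
    by (simp add: norm_mult mult_ac)
  also have "\<dots> \<le> (cmod (deriv (comb J) z) * exp (- W z)) * exp (xs J)"
  proof (intro mult_left_mono)
    have "ln (cmod z) \<le> xs J" using k xs_mono[of "Suc k" J] by simp
    then show "cmod z \<le> exp (xs J)" using z0 by (simp add: ln_ge_cmod)
  qed auto
  finally show ?thesis by (simp add: field_simps)
qed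

text \<open>The slope \<open>d\<close> satisfies
  \<open>d * (z - y) = breg y z + breg z y \<ge> 64\<close>, so a band of height 4 has logarithmic
  length at most \<open>(z - y) / 16\<close>. Passing to area costs at most
  \<open>exp (2 * (z - y)) \<le> 9\<close>.\<close>

lemma measure_bad_le: "measure lborel (bad k) \<le> 9 / 16 * (pi * ((exp (xs (Suc k)))\<^sup>2 - (exp (xs k))\<^sup>2))"
proof -
  define y where "y = xs k"
  define z where "z = xs (Suc k)"
  define d where "d = real (ns (Suc k)) - real (ns k)"
  have yz: "y < z" "z \<le> y + 1" using xs_less gap by (auto simp: y_def z_def)
  have d: "d > 0" using ns_less[of k] by (simp add: d_def)
  have "d * (z - y) = breg y z + breg z y"
    using breg_three_point[of y y z] by (simp add: d_def y_def z_def \<nu>_xs algebra_simps)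
  then have dz: "64 \<le> d * (z - y)" using sepR[of k] sepL[of k] by (simp add: y_def z_def)
  \<comment> \<open>The crossing point of the two peaks. \<open>lo\<close> and \<open>hi\<close>
    clip its neighbourhood to the interval; the outer \<open>max\<close> keeps
    \<open>lo \<le> hi\<close> if nothing is left.\<close>
  define \<xi> where "\<xi> = z - breg y z / d"
  define lo where "lo = max y (\<xi> - 2 / d)"
  define hi where "hi = max lo (min z (\<xi> + 2 / d))"
  have hl: "lo \<le> hi" "hi - lo \<le> 4 / d" 
  proof -
    have "0 < 2 / d" "4 / d = 2 / d + 2 / d" using d by simp_all
    then show "lo \<le> hi" "hi - lo \<le> 4 / d" unfolding lo_def hi_def by linarith+
  qed
  have sub: "bad k \<subseteq> {w. exp lo \<le> cmod w \<and> cmod w \<le> exp hi}"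
  proof
    fix w assume w: "w \<in> bad k"
    then have w0: "w \<noteq> 0" and wx: "y \<le> ln (cmod w)" "ln (cmod w) \<le> z"
      and D: "\<bar>breg y (ln (cmod w)) - breg z (ln (cmod w))\<bar> < 2"
      by (auto simp: bad_def y_def z_def)
    have "breg y (ln (cmod w)) - breg z (ln (cmod w)) = d * (ln (cmod w) - z) + breg y z"
      using breg_three_point[of y "ln (cmod w)" z] by (simp only: d_def y_def z_def \<nu>_xs)
    also have "\<dots> = d * (ln (cmod w) - \<xi>)" using d by (simp add: \<xi>_def field_simps)
    finally have "breg y (ln (cmod w)) - breg z (ln (cmod w)) = d * (ln (cmod w) - \<xi>)" .
    then have "d * \<bar>ln (cmod w) - \<xi>\<bar> < 2" using D d by (simp add: abs_mult)
    then have "\<bar>ln (cmod w) - \<xi>\<bar> < 2 / d" using d by (simp add: field_simps)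
    then have "lo \<le> ln (cmod w)" "ln (cmod w) \<le> hi" using wx unfolding lo_def hi_def by linarith+
    then show "w \<in> {w. exp lo \<le> cmod w \<and> cmod w \<le> exp hi}"
      using w0 by (simp add: ln_le_cmod ln_ge_cmod)
  qed
  have "emeasure lborel {w :: complex. exp lo \<le> cmod w \<and> cmod w \<le> exp hi} \<le> emeasure lborel (cball (0::complex) (exp hi))"
    by (intro emeasure_mono) auto
  also have "\<dots> < \<infinity>" by (simp add: emeasure_cball)
  finally have "{w :: complex. exp lo \<le> cmod w \<and> cmod w \<le> exp hi} \<in> fmeasurable lborel"
    by (simp add: fmeasurable_def)
  then have "measure lborel (bad k) \<le> measure lborel {w :: complex. exp lo \<le> cmod w \<and> cmod w \<le> exp hi}"
    using sub by (intro measure_mono_fmeasurable) auto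
  also have "\<dots> = pi * ((exp hi)\<^sup>2 - (exp lo)\<^sup>2)" using hl by (intro measure_annulus) auto
  also have "\<dots> \<le> pi * (9 / 16 * ((exp z)\<^sup>2 - (exp y)\<^sup>2))"
  proof (intro mult_left_mono)
    have "hi \<le> z \<or> hi = lo" unfolding hi_def lo_def by linarith
    then show "(exp hi)\<^sup>2 - (exp lo)\<^sup>2 \<le> 9 / 16 * ((exp z)\<^sup>2 - (exp y)\<^sup>2)"
    proof
      assume "hi = lo"
      moreover have "(exp y)\<^sup>2 \<le> (exp z)\<^sup>2" using yz by (intro power_mono) auto
      ultimately show ?thesis by simp
    next
      assume hz: "hi \<le> z"
      have "1 - exp (- (2 * (hi - lo))) \<le> 2 * (hi - lo)"
        using exp_ge_add_one_self[of "- (2 * (hi - lo))"] by linarith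
      then have "exp (2 * hi) * (1 - exp (- (2 * (hi - lo)))) \<le> exp (2 * z) * (2 * (hi - lo))"
        using hl hz by (intro mult_mono) auto
      moreover have "exp (2 * hi) * exp (- (2 * (hi - lo))) = exp (2 * lo)"
        by (simp add: exp_add[symmetric] algebra_simps)
      ultimately have "(exp hi)\<^sup>2 - (exp lo)\<^sup>2 \<le> exp (2 * z) * (2 * (hi - lo))"
        by (simp add: exp_double[symmetric] right_diff_distrib)
      also have "\<dots> \<le> exp (2 * z) * ((z - y) / 8)"
      proof (intro mult_left_mono)
        have "4 / d \<le> (z - y) / 16" using d dz by (simp add: field_simps)
        then show "2 * (hi - lo) \<le> (z - y) / 8" using hl by simp
      qed simp
      also have "\<dots> \<le> (9 * exp (2 * y)) * ((z - y) / 8)"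
      proof (intro mult_right_mono)
        have "exp (2 * z) \<le> exp (2 * y + 2 * 1)" using yz by simp
        also have "\<dots> = exp (2 * y) * (exp 1)\<^sup>2" by (simp only: exp_add exp_double)
        also have "\<dots> \<le> exp (2 * y) * 3\<^sup>2" using exp_le by (intro mult_left_mono power_mono) auto
        finally show "exp (2 * z) \<le> 9 * exp (2 * y)" by simp
      qed (use yz in auto)
      also have "\<dots> = 9 / 16 * (exp (2 * y) * (2 * (z - y)))" by simp
      also have "\<dots> \<le> 9 / 16 * (exp (2 * y) * (exp (2 * (z - y)) - 1))"
      proof (intro mult_left_mono)
        show "2 * (z - y) \<le> exp (2 * (z - y)) - 1" using exp_ge_add_one_self[of "2 * (z - y)"] by linarith
      qed auto
      also have "exp (2 * y) * (exp (2 * (z - y)) - 1) = (exp z)\<^sup>2 - (exp y)\<^sup>2"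
        by (simp add: exp_double[symmetric] right_diff_distrib exp_add[symmetric])
      finally show ?thesis .
    qed
  qed simp
  also have "\<dots> = 9 / 16 * (pi * ((exp z)\<^sup>2 - (exp y)\<^sup>2))" by (rule mult.left_commute)
  finally show ?thesis unfolding y_def z_def .
qed

lemma good_subset: "good J \<subseteq> {z. exp (xs 0) \<le> cmod z \<and> cmod z \<le> exp (xs J)}"
proof
  fix z assume "z \<in> good J"
  then obtain k where z: "z \<noteq> 0" and k: "k < J" "xs k \<le> ln (cmod z)" "ln (cmod z) \<le> xs (Suc k)"
    by (auto simp: good_def)
  then have "xs 0 \<le> ln (cmod z)" "ln (cmod z) \<le> xs J"
    using xs_mono[of 0 k] xs_mono[of "Suc k" J] by simp_all
  with z show "z \<in> {z. exp (xs 0) \<le> cmod z \<and> cmod z \<le> exp (xs J)}"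
    by (simp add: ln_le_cmod ln_ge_cmod)
qed

lemma good_fmeasurable: "good J \<in> fmeasurable lborel"
  using annulus_fmeasurable good_subset by (rule fmeasurableI2) simp

lemma bad_fmeasurable: "bad k \<in> fmeasurable lborel"
proof (rule fmeasurableI2[OF annulus_fmeasurable])
  show "bad k \<subseteq> {z. exp (xs k) \<le> cmod z \<and> cmod z \<le> exp (xs (Suc k))}"
    by (auto simp: bad_def ln_le_cmod ln_ge_cmod)
qed simp

lemma measure_good_ge:
  assumes J: "0 < J"
  shows "7 / 16 * (pi * ((exp (xs J))\<^sup>2 - (exp (xs 0))\<^sup>2)) \<le> measure lborel (good J)"
proof -
  have "{z :: complex. exp (xs 0) \<le> cmod z \<and> cmod z \<le> exp (xs J)} \<subseteq> good J \<union> (\<Union>k<J. bad k)"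
  proof
    fix z :: complex assume "z \<in> {z. exp (xs 0) \<le> cmod z \<and> cmod z \<le> exp (xs J)}"
    then have z: "exp (xs 0) \<le> cmod z" "cmod z \<le> exp (xs J)" by auto
    have z0: "z \<noteq> 0" using z(1) exp_gt_zero[of "xs 0"] by (auto simp del: exp_gt_zero)
    then have "xs 0 \<le> ln (cmod z)" "ln (cmod z) \<le> xs J" using z by (simp_all add: ln_le_cmod ln_ge_cmod)
    then obtain k where "k < J" "xs k \<le> ln (cmod z)" "ln (cmod z) \<le> xs (Suc k)" using between J by blast
    then show "z \<in> good J \<union> (\<Union>k<J. bad k)"
      using z0 unfolding good_def bad_def by fastforce
  qed
  then have "measure lborel {z :: complex. exp (xs 0) \<le> cmod z \<and> cmod z \<le> exp (xs J)} \<le>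
      measure lborel (good J \<union> (\<Union>k<J. bad k))"
    using good_fmeasurable bad_fmeasurable annulus_fmeasurable
    by (intro measure_mono_fmeasurable fmeasurable.Un fmeasurable.finite_UN) (auto dest: fmeasurableD)
  also have "\<dots> \<le> measure lborel (good J) + measure lborel (\<Union>k<J. bad k)"
    by (intro measure_Un_le) auto
  also have "measure lborel (\<Union>k<J. bad k) \<le> (\<Sum>k<J. measure lborel (bad k))"
    using bad_fmeasurable by (intro measure_UNION_le) auto
  also have "\<dots> \<le> (\<Sum>k<J. 9 / 16 * (pi * ((exp (xs (Suc k)))\<^sup>2 - (exp (xs k))\<^sup>2)))"
    by (intro sum_mono measure_bad_le)
  also have "\<dots> = 9 / 16 * (pi * ((exp (xs J))\<^sup>2 - (exp (xs 0))\<^sup>2))"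
    by (simp only: sum_distrib_left[symmetric] sum_lessThan_telescope[of "\<lambda>k. (exp (xs k))\<^sup>2"])
  also have "measure lborel {z :: complex. exp (xs 0) \<le> cmod z \<and> cmod z \<le> exp (xs J)} =
     pi * ((exp (xs J))\<^sup>2 - (exp (xs 0))\<^sup>2)"
    using xs_mono[of 0 J] by (intro measure_annulus) auto
  finally show ?thesis by (simp add: field_simps)
qed

text \<open>On the annulus the sum of all peaks is at most 3, and outside it the nearest end peak
  dominates. Hence the number of peaks does not enter, and the bound is a multiple of the area of
  the outer disc.\<close>

lemma nn_integral_comb_le:
  assumes J: "0 < J" and p: "p > 0"
    and y: "xs 0 \<ge> X0 + 1" "1 \<le> \<kappa> * exp (2 * xs 0)" "(20 / p)\<^sup>2 \<le> \<kappa> * exp (2 * xs 0)"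
  shows "(\<integral>\<^sup>+z. ennreal ((cmod (comb J z) * exp (- W z)) powr p) \<partial>lborel)
    \<le> ennreal (3 powr p * pi * (1 + 4 * exp (p / 2)) * exp (2 * xs J))"
proof -
  have peak: "(\<integral>\<^sup>+z. ennreal (exp (- p * breg (xs k) (ln (cmod z)))) \<partial>lborel) \<le> ennreal (2 * pi * exp (p / 2) * exp (2 * xs J))"
    if k: "k \<le> J" for k
  proof -
    have x0k: "xs 0 \<le> xs k" using xs_mono[of 0 k] by simp
    define E where "E = \<kappa> * exp (2 * xs k)"
    have "\<kappa> * exp (2 * xs 0) \<le> E" using x0k \<kappa>_pos by (simp add: E_def)
    then have E: "1 \<le> E" "(20 / p)\<^sup>2 \<le> E" using y by linarith+
    have xk: "xs k \<ge> X0 + 1" using y x0k by linarith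
    obtain a b where a: "0 < a" "a \<le> 1 / sqrt E" and b: "0 < b" "b \<le> 1 / sqrt E"
      and B: "\<And>x. \<bar>x - xs k\<bar> / (a + b) - 1 \<le> breg (xs k) x"
      using breg_widths[of "xs k", folded E_def, OF xk E(1)] by metis
    have sE: "sqrt E \<ge> 1" "20 / p \<le> sqrt E" using E p by (auto intro: real_le_rsqrt)
    have "20 * (1 / sqrt E) \<le> p" using sE p by (simp add: field_simps)
    moreover have "10 * (a + b) \<le> 10 * (1 / sqrt E + 1 / sqrt E)"
      using a b by (intro mult_left_mono add_mono) auto
    ultimately have w: "0 < a + b" "10 * (a + b) \<le> p" using a b by simp_all
    have "(\<integral>\<^sup>+z. ennreal (exp (- p * breg (xs k) (ln (cmod z)))) \<partial>lborel) \<le>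
       ennreal (16 * pi * exp (p / 2) / p * (a + b) * exp (2 * xs k))"
      by (rule nn_integral_radial_peak_le[OF p w B])
    also have "\<dots> \<le> ennreal (2 * pi * exp (p / 2) * exp (2 * xs J))"
    proof (rule ennreal_leI, rule mult_mono)
      have "16 * (a + b) / p \<le> 2" using w p by (simp add: field_simps)
      then have "pi * exp (p / 2) * (16 * (a + b) / p) \<le> pi * exp (p / 2) * 2" by (intro mult_left_mono) auto
      then show "16 * pi * exp (p / 2) / p * (a + b) \<le> 2 * pi * exp (p / 2)" by (simp add: field_simps)
    qed (use xs_mono[OF k] in auto)
    finally show ?thesis .
  qed
  define Ann where "Ann = {z :: complex. exp (xs 0) \<le> cmod z \<and> cmod z \<le> exp (xs J)}"
  have [measurable]: "Ann \<in> sets borel" unfolding Ann_def by measurable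
  have le: "(cmod (comb J z) * exp (- W z)) powr p \<le>
     3 powr p * (indicator Ann z + (exp (- p * breg (xs 0) (ln (cmod z))) + exp (- p * breg (xs J) (ln (cmod z)))))"
    if z: "z \<noteq> 0" for z
  proof -
    define x where "x = ln (cmod z)"
    have up: "cmod (comb J z) * exp (- W z) \<le> (\<Sum>j\<le>J. h j x)" using norm_comb_le[OF z] by (simp add: x_def)
    have one: "(cmod (comb J z) * exp (- W z)) powr p \<le> 3 powr p * exp (- p * breg (xs k) x)"
      if "(\<Sum>j\<le>J. h j x) \<le> 3 * h k x" for k
    proof -
      have "(cmod (comb J z) * exp (- W z)) powr p \<le> (3 * h k x) powr p"
        using up that p by (intro powr_mono2) auto
      also have "\<dots> = 3 powr p * exp (- p * breg (xs k) x)"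
        using h_pos[of k x] by (simp add: powr_mult h_def exp_powr_real mult.commute)
      finally show ?thesis .
    qed
    consider "x \<le> xs 0" | "xs J \<le> x" | "xs 0 \<le> x" "x \<le> xs J" by linarith
    then show ?thesis
    proof cases
      case 1
      note one[OF sum_h_le_left[OF 1]]
      also have "3 powr p * exp (- p * breg (xs 0) x) \<le>
        3 powr p * (indicator Ann z + (exp (- p * breg (xs 0) x) + exp (- p * breg (xs J) x)))"
        by (intro mult_left_mono) (auto simp: indicator_def)
      finally show ?thesis by (simp add: x_def)
    next
      case 2
      note one[OF sum_h_le_right[OF 2]]
      also have "3 powr p * exp (- p * breg (xs J) x) \<le>
        3 powr p * (indicator Ann z + (exp (- p * breg (xs 0) x) + exp (- p * breg (xs J) x)))"
        by (intro mult_left_mono) (auto simp: indicator_def)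
      finally show ?thesis by (simp add: x_def)
    next
      case 3
      then have zA: "z \<in> Ann" using z by (simp add: Ann_def x_def ln_le_cmod ln_ge_cmod)
      have "(cmod (comb J z) * exp (- W z)) powr p \<le> 3 powr p"
        using up sum_h_le[OF J, of x] p by (intro powr_mono2) auto
      also have "3 powr p * 1 \<le>
        3 powr p * (indicator Ann z + (exp (- p * breg (xs 0) x) + exp (- p * breg (xs J) x)))"
        using zA by (intro mult_left_mono) auto
      finally show ?thesis by (simp add: x_def)
    qed
  qed
  have "(\<integral>\<^sup>+z. ennreal ((cmod (comb J z) * exp (- W z)) powr p) \<partial>lborel) \<le>
     (\<integral>\<^sup>+z. ennreal (3 powr p) * (indicator Ann z + (ennreal (exp (- p * breg (xs 0) (ln (cmod z)))) +
        ennreal (exp (- p * breg (xs J) (ln (cmod z)))))) \<partial>lborel)"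
  proof (rule nn_integral_mono_AE, rule AE_mp[OF AE_lborel_singleton[of 0]], rule AE_I2, rule impI)
    fix z :: complex assume "z \<noteq> 0"
    from ennreal_leI[OF le[OF this]]
    show "ennreal ((cmod (comb J z) * exp (- W z)) powr p) \<le>
      ennreal (3 powr p) * (indicator Ann z + (ennreal (exp (- p * breg (xs 0) (ln (cmod z)))) +
        ennreal (exp (- p * breg (xs J) (ln (cmod z))))))"
      by (simp add: ennreal_mult' ennreal_plus ennreal_indicator del: ennreal_plus[symmetric])
  qed
  also have "\<dots> = ennreal (3 powr p) * (emeasure lborel Ann + ((\<integral>\<^sup>+z. ennreal (exp (- p * breg (xs 0) (ln (cmod z)))) \<partial>lborel)
     + (\<integral>\<^sup>+z. ennreal (exp (- p * breg (xs J) (ln (cmod z)))) \<partial>lborel)))"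
    by (simp add: nn_integral_cmult nn_integral_add)
  also have "\<dots> \<le> ennreal (3 powr p) * (ennreal (pi * exp (2 * xs J)) + (ennreal (2 * pi * exp (p / 2) * exp (2 * xs J))
     + ennreal (2 * pi * exp (p / 2) * exp (2 * xs J))))"
  proof (intro mult_left_mono add_mono peak)
    have "emeasure lborel Ann \<le> emeasure lborel (cball (0 :: complex) (exp (xs J)))"
      unfolding Ann_def by (intro emeasure_mono) auto
    also have "\<dots> = ennreal (pi * exp (2 * xs J))"
      by (simp add: emeasure_cball unit_ball_vol_2 exp_double)
    finally show "emeasure lborel Ann \<le> ennreal (pi * exp (2 * xs J))" .
  qed auto
  also have "\<dots> = ennreal (3 powr p * (pi * exp (2 * xs J) + (2 * pi * exp (p / 2) * exp (2 * xs J) + 2 * pi * exp (p / 2) * exp (2 * xs J))))"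
    by (subst ennreal_plus[symmetric], simp, simp)+ (rule ennreal_mult'[symmetric], simp)
  also have "3 powr p * (pi * exp (2 * xs J) + (2 * pi * exp (p / 2) * exp (2 * xs J) + 2 * pi * exp (p / 2) * exp (2 * xs J))) =
     3 powr p * pi * (1 + 4 * exp (p / 2)) * exp (2 * xs J)"
    by (simp add: algebra_simps)
  finally show ?thesis .
qed

end

section \<open>Choice of the exponents\<close>

context log_convex_weight begin

text \<open>At distance \<open>1 / 2\<close> or more the minimum in \<open>breg_ge\<close> is at
  least \<open>1 / 4\<close>, and \<open>128 / 4 = 32\<close>.\<close>

lemma separated_if:
  assumes y: "y \<ge> X0 + 1" "128 \<le> \<kappa> * exp (2 * y)" and z: "y + 1 / 2 \<le> z"
  shows "32 \<le> breg y z" and "32 \<le> breg z y"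
proof -
  define u where "u = z - y"
  have u: "1 / 2 \<le> u" using z by (simp add: u_def)
  have "(1 / 2)\<^sup>2 \<le> u\<^sup>2" using u by (intro power_mono) auto
  then have mn: "1 / 4 \<le> min (u\<^sup>2) \<bar>u\<bar>" using u by (simp add: power2_eq_square)
  have *: "32 \<le> \<kappa> * exp (2 * w) * min (v\<^sup>2) \<bar>v\<bar>" if "128 \<le> \<kappa> * exp (2 * w)" "1 / 4 \<le> min (v\<^sup>2) \<bar>v\<bar>" for v w
  proof -
    have "128 * (1 / 4) \<le> \<kappa> * exp (2 * w) * min (v\<^sup>2) \<bar>v\<bar>"
      by (rule mult_mono[OF that]) (use that in auto)
    then show ?thesis by simp
  qed
  show "32 \<le> breg y z"
    using *[OF y(2) mn] breg_ge[OF y(1), of u] by (simp add: u_def)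
  have "\<kappa> * exp (2 * y) \<le> \<kappa> * exp (2 * z)" using \<kappa>_pos z by simp
  then have "128 \<le> \<kappa> * exp (2 * z)" using y by linarith
  then have "32 \<le> \<kappa> * exp (2 * z) * min ((- u)\<^sup>2) \<bar>- u\<bar>" by (rule *) (use mn in simp)
  also have "\<dots> \<le> breg z (z + - u)" using y z by (intro breg_ge) linarith
  finally show "32 \<le> breg z y" by (simp add: u_def)
qed

lemma breg_sym_sum: "breg y z + breg z y = (\<nu> z - \<nu> y) * (z - y)"
  by (simp add: breg_def algebra_simps)

text \<open>The greedy choice of the next exponent keeps the peaks separated and leaves no gap between them.\<close>

lemma exists_peak_sequence:
  assumes Y: "Y \<ge> X0 + 1" "128 \<le> \<kappa> * exp (2 * Y)" and n0: "\<nu> Y \<le> real n0" "0 < n0"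
  shows "\<exists>xs ns. peak_sequence W \<phi> \<nu> \<phi>2 c0 X0 xs ns \<and> Y \<le> xs 0 \<and> (\<forall>X. \<exists>k. X \<le> xs k)"
proof -
  define pt where "pt n = (SOME x. Y \<le> x \<and> \<nu> x = real n)" for n
  have pt: "Y \<le> pt n" "\<nu> (pt n) = real n" if "n0 \<le> n" for n
  proof -
    have "\<nu> Y \<le> real n" using n0 that by linarith
    then have "\<exists>x. Y \<le> x \<and> \<nu> x = real n" using \<nu>_surj by blast
    from someI_ex[OF this] show "Y \<le> pt n" "\<nu> (pt n) = real n" by (auto simp: pt_def)
  qed
  have pt_mono: "pt m \<le> pt n" if "n0 \<le> m" "m \<le> n" for m n
  proof (rule ccontr)
    assume "\<not> pt m \<le> pt n"
    then have "\<nu> (pt n) < \<nu> (pt m)" by (intro \<nu>_strict_mono) simp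
    then show False using that pt(2)[of m] pt(2)[of n] by simp
  qed
  have big: "128 \<le> \<kappa> * exp (2 * pt n)" "X0 + 1 \<le> pt n" if "n0 \<le> n" for n
  proof -
    have "\<kappa> * exp (2 * Y) \<le> \<kappa> * exp (2 * pt n)" using \<kappa>_pos pt(1)[OF that] by simp
    then show "128 \<le> \<kappa> * exp (2 * pt n)" using Y by linarith
    show "X0 + 1 \<le> pt n" using Y pt(1)[OF that] by linarith
  qed
  have unbdd: "X < pt n" if "n0 \<le> n" "\<nu> X < real n" for X n
  proof (rule ccontr)
    assume "\<not> X < pt n"
    then have "\<nu> (pt n) \<le> \<nu> X" by (intro \<nu>_mono) simp
    then show False using that pt(2)[of n] by simp
  qed
  define sep where "sep n m \<longleftrightarrow> 32 \<le> breg (pt n) (pt m) \<and> 32 \<le> breg (pt m) (pt n)" for n m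
  have sepI: "sep n m" if "n0 \<le> n" "pt n + 1 / 2 \<le> pt m" for n m
    using separated_if[OF big(2,1)[OF that(1)] that(2)] by (simp add: sep_def)
  \<comment> \<open>Minimality is what yields \<open>cover\<close>: the exponent just before
    \<open>nxt n\<close> is either \<open>n\<close> itself or not yet separated from it.\<close>
  define nxt where "nxt n = (LEAST m. n < m \<and> sep n m)" for n
  have nxt: "n < nxt n" "sep n (nxt n)" "\<And>m. n < m \<Longrightarrow> m < nxt n \<Longrightarrow> \<not> sep n m" if n: "n0 \<le> n" for n
  proof -
    obtain m :: nat where m: "\<nu> (pt n + 1 / 2) < real m" using reals_Archimedean2 by blast
    define m' where "m' = max m (Suc n)"
    have "pt n + 1 / 2 < pt m'" using m n by (intro unbdd) (auto simp: m'_def)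
    then have "n < m' \<and> sep n m'" using sepI[OF n, of m'] by (auto simp: m'_def)
    then have "n < nxt n \<and> sep n (nxt n)" unfolding nxt_def by (rule LeastI)
    then show "n < nxt n" "sep n (nxt n)" by auto
    show "\<not> sep n m" if "n < m" "m < nxt n" for m
      using not_less_Least[of m "\<lambda>m. n < m \<and> sep n m"] that by (auto simp: nxt_def)
  qed
  have step: "pt (nxt n) \<le> pt n + 1 \<and>
      (\<forall>x. pt n \<le> x \<longrightarrow> x \<le> pt (nxt n) \<longrightarrow> breg (pt n) x \<le> 33 \<or> breg (pt (nxt n)) x \<le> 33)" if n: "n0 \<le> n" for n
  proof -
    define m where "m = nxt n - 1"
    have m: "n \<le> m" "nxt n = Suc m" using nxt(1)[OF n] by (auto simp: m_def)
    then have m0: "n0 \<le> m" using n by simp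
    define y where "y = pt n"
    define y' where "y' = pt m"
    define z where "z = pt (Suc m)"
    have ord: "y \<le> y'" "y' \<le> z" using pt_mono n m m0 by (auto simp: y_def y'_def z_def)
    have nsep: "y' = y \<or> \<not> sep n m" using nxt(3)[OF n, of m] m by (cases "n = m") (auto simp: y_def y'_def)
    have g1: "y' \<le> y + 1 / 2"
    proof (rule ccontr)
      assume c: "\<not> ?thesis"
      then have "sep n m" using sepI[OF n, of m] by (simp add: y_def y'_def)
      then show False using nsep c by simp
    qed
    have one: "\<nu> z - \<nu> y' = 1" using pt(2)[of "Suc m"] pt(2)[OF m0] m0 by (simp add: y'_def z_def)
    \<comment> \<open>For consecutive exponents the two divergences add up to \<open>z - y'\<close>,
      whereas the lower bound of \<open>breg_ge\<close> would exceed this at distances over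
      \<open>1 / 2\<close>.\<close>
    have g2: "z \<le> y' + 1 / 2"
    proof (rule ccontr)
      assume c: "\<not> ?thesis"
      define u where "u = z - y'"
      have u: "1 / 2 \<le> u" using c by (simp add: u_def)
      have "u / 2 \<le> u\<^sup>2" using u by (simp add: power2_eq_square)
      then have "u / 2 \<le> min (u\<^sup>2) \<bar>u\<bar>" using u by simp
      then have "128 * (u / 2) \<le> \<kappa> * exp (2 * y') * min (u\<^sup>2) \<bar>u\<bar>"
        using big[OF m0] u by (intro mult_mono) (auto simp: y'_def)
      also have "\<dots> \<le> breg y' z" using breg_ge[of y' u] big[OF m0] by (simp add: y'_def u_def)
      also have "\<dots> \<le> u" using breg_sym_sum[of y' z] breg_nonneg[of z y'] one by (simp add: u_def)
      finally show False using u by simp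
    qed
    have "breg y x \<le> 33 \<or> breg z x \<le> 33" if x: "y \<le> x" "x \<le> z" for x
    proof -
      \<comment> \<open>Raising the exponent by one changes the divergence by at most
        \<open>z - x \<le> 1\<close>; this is the step from 32 to 33.\<close>
      have eq: "breg z x = breg y' x + (z - x) - breg y' z"
        using breg_three_point[of y' x z] one by simp
      show ?thesis
      proof (cases "y' \<le> x")
        case True
        then have "breg y' x \<le> breg y' z" using x by (intro breg_mono_right)
        then show ?thesis using eq x g1 g2 by linarith
      next
        case False
        then have "\<not> sep n m" using nsep x by auto
        then have "breg y y' < 32 \<or> breg y' y < 32" by (auto simp: sep_def y_def y'_def)
        moreover have "breg y x \<le> breg y y'" using x False by (intro breg_mono_right) auto
        moreover have "breg y' x \<le> breg y' y" using x False by (intro breg_mono_left) auto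
        ultimately show ?thesis using eq x g1 g2 breg_nonneg[of y' z] by linarith
      qed
    qed
    then show ?thesis using g1 g2 by (auto simp: y_def z_def m(2))
  qed
  define ns where "ns k = (nxt ^^ k) n0" for k
  have ns_Suc: "ns (Suc k) = nxt (ns k)" for k by (simp add: ns_def)
  have ns_ge: "n0 \<le> ns k" for k
  proof (induction k)
    case (Suc k)
    then show ?case using nxt(1)[of "ns k"] by (simp add: ns_Suc)
  qed (simp add: ns_def)
  have ns_less: "ns k < ns (Suc k)" for k
    using nxt(1)[OF ns_ge] by (simp add: ns_Suc)
  have ns_k: "k \<le> ns k" for k
  proof (induction k)
    case (Suc k)
    then show ?case using ns_less[of k] by simp
  qed simp
  have "peak_sequence W \<phi> \<nu> \<phi>2 c0 X0 (\<lambda>k. pt (ns k)) ns"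
  proof unfold_locales
    fix k x
    show "\<nu> (pt (ns k)) = real (ns k)" by (rule pt(2)[OF ns_ge])
    show "ns k < ns (Suc k)" by (rule ns_less)
    show "0 < ns 0" using n0 by (simp add: ns_def)
    show "32 \<le> breg (pt (ns k)) (pt (ns (Suc k)))" "32 \<le> breg (pt (ns (Suc k))) (pt (ns k))"
      using nxt(2)[OF ns_ge[of k]] by (auto simp: sep_def ns_Suc)
    show "pt (ns (Suc k)) \<le> pt (ns k) + 1" using step[OF ns_ge[of k]] by (simp add: ns_Suc)
    show "breg (pt (ns k)) x \<le> 33 \<or> breg (pt (ns (Suc k))) x \<le> 33"
      if "pt (ns k) \<le> x" "x \<le> pt (ns (Suc k))"
      using step[OF ns_ge[of k]] that by (simp add: ns_Suc)
  qed
  moreover have "Y \<le> pt (ns 0)" by (rule pt(1)[OF ns_ge])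
  moreover have "\<exists>k. X \<le> pt (ns k)" for X
  proof -
    obtain k :: nat where k: "\<nu> X < real k" using reals_Archimedean2 by blast
    have "X < pt (ns k)" using k ns_k[of k] ns_ge[of k] by (intro unbdd) auto
    then show ?thesis by (auto intro: less_imp_le)
  qed
  ultimately show ?thesis by (intro exI[of _ "\<lambda>k. pt (ns k)"] exI[of _ ns]) auto
qed

section \<open>Conclusion for \<open>q \<le> p\<close>\<close>

lemma not_fock_bounded_ge:
  assumes q: "0 < q" and qp: "q \<le> p"
  shows "\<not> fock_bounded p q W deriv"
proof -
  have p: "0 < p" using q qp by (rule less_le_trans)
  define P where "P = (if p = \<infinity> then 1 else enn2real p)"
  have P: "P > 0" using p by (auto simp: P_def enn2real_positive_iff less_top)
  \<comment> \<open>The factor \<open>exp 4\<close> compares the outer disc with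
    \<open>exp (2 * xs 0)\<close>, as \<open>xs J \<le> xs 0 + 2\<close>.\<close>
  define K0 where "K0 = 3 powr P * pi * (1 + 4 * exp (P / 2)) * exp 4"
  define K where "K = max 3 K0"
  obtain X1 where X1: "X1 \<ge> X0" "\<And>x. x \<ge> X1 \<Longrightarrow> c0 / 4 * exp (2 * x) \<le> \<nu> x" using \<nu>_ge by blast
  show ?thesis
  proof (rule fock_unboundedI[where K = K and c = 1])
    fix L :: real
    have "\<forall>\<^sub>F y in at_top. X0 + 1 \<le> y \<and> X1 \<le> y \<and> 0 \<le> y \<and> 128 \<le> \<kappa> * exp (2 * y) \<and> (20 / P)\<^sup>2 \<le> \<kappa> * exp (2 * y)
       \<and> L \<le> c0 / 8 * exp (y - 35)"
    proof -
      have 1: "\<forall>\<^sub>F y in at_top. s \<le> \<kappa> * exp (2 * y)" for s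
        using eventually_le_exp[of \<kappa> 2 s 0] \<kappa>_pos by simp
      have 2: "\<forall>\<^sub>F y in at_top. L \<le> c0 / 8 * exp (y - 35)"
        using eventually_le_exp[of "c0 / 8" 1 L "- 35"] c0 by simp
      show ?thesis by (intro eventually_conj eventually_ge_at_top 1 2)
    qed
    then obtain Y where Y: "\<And>y. y \<ge> Y \<Longrightarrow> X0 + 1 \<le> y \<and> X1 \<le> y \<and> 0 \<le> y \<and> 128 \<le> \<kappa> * exp (2 * y)
       \<and> (20 / P)\<^sup>2 \<le> \<kappa> * exp (2 * y) \<and> L \<le> c0 / 8 * exp (y - 35)"
      by (auto simp: eventually_at_top_linorder)
    define n0 where "n0 = Suc (nat \<lceil>\<nu> Y\<rceil>)"
    have n0: "\<nu> Y \<le> real n0" "0 < n0" unfolding n0_def by linarith+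
    obtain xs ns where "peak_sequence W \<phi> \<nu> \<phi>2 c0 X0 xs ns" and Y0: "Y \<le> xs 0" and unbdd: "\<And>X. \<exists>k. X \<le> xs k"
      using exists_peak_sequence[OF _ _ n0] Y[of Y] by blast
    then interpret S: peak_sequence W \<phi> \<nu> \<phi>2 c0 X0 xs ns by simp
    have y: "X0 + 1 \<le> xs 0" "X1 \<le> xs 0" "0 \<le> xs 0" "1 \<le> \<kappa> * exp (2 * xs 0)" "(20 / P)\<^sup>2 \<le> \<kappa> * exp (2 * xs 0)"
      "L \<le> c0 / 8 * exp (xs 0 - 35)"
      using Y[OF Y0] by auto
    \<comment> \<open>The first peak at logarithmic distance at least 1; by \<open>gap\<close> it is
      at distance at most 2, so the area is of order \<open>exp (2 * xs 0)\<close>.\<close>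
    define J where "J = (LEAST k. xs 0 + 1 \<le> xs k)"
    have J1: "xs 0 + 1 \<le> xs J" unfolding J_def by (rule LeastI_ex[OF unbdd])
    have J0: "0 < J" using J1 by (cases J) auto
    have "\<not> xs 0 + 1 \<le> xs (J - 1)" using J0 unfolding J_def by (intro not_less_Least) simp
    then have J2: "xs J \<le> xs 0 + 2" using S.gap[of "J - 1"] J0 by simp
    define A where "A = exp (2 * xs 0)"
    have A: "1 \<le> A" using y by (simp add: A_def)
    have hol: "S.comb J holomorphic_on UNIV"
      unfolding S.comb_def[abs_def] by (intro holomorphic_intros)
    have zero: "S.comb J 0 = 0" by (simp add: S.comb_def zero_power S.ns_gt_0)
    show "\<exists>f E A. f holomorphic_on UNIV \<and> (\<forall>z. cmod (f z) * exp (- W z) \<le> K) \<and>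
      E \<in> sets lborel \<and> emeasure lborel E < \<infinity> \<and> 0 < A \<and> 1 * A \<le> measure lborel E \<and>
      (\<forall>z\<in>E. L \<le> cmod (deriv f z) * exp (- W z)) \<and>
      (p \<noteq> \<infinity> \<longrightarrow> (\<integral>\<^sup>+z. ennreal ((cmod (f z) * exp (- W z)) powr enn2real p) \<partial>lborel) \<le> ennreal (K * A)) \<and>
      (p \<le> q \<and> A \<le> K \<or> q \<le> p \<and> 1 \<le> A)"
    proof (intro exI[of _ "S.comb J"] exI[of _ "S.good J"] exI[of _ A] conjI allI impI ballI)
      fix z :: complex
      show "cmod (S.comb J z) * exp (- W z) \<le> K"
      proof (cases "z = 0")
        case False
        have "cmod (S.comb J z) * exp (- W z) \<le> 3"
          using S.norm_comb_le[OF False, of J] S.sum_h_le[OF J0, of "ln (cmod z)"] by linarith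
        then show ?thesis by (simp add: K_def)
      qed (simp add: zero K_def)
    next
      have "3 * A \<le> (exp (xs J))\<^sup>2"
      proof -
        have "A * 3 \<le> A * exp 2" using A exp_ge_add_one_self[of "2 :: real"] by (intro mult_left_mono) auto
        also have "\<dots> = exp (2 * (xs 0 + 1))" by (simp add: A_def exp_add[symmetric])
        also have "\<dots> \<le> exp (2 * xs J)" using J1 by simp
        finally show ?thesis by (simp add: exp_double)
      qed
      then have "2 * A \<le> (exp (xs J))\<^sup>2 - (exp (xs 0))\<^sup>2" by (simp add: A_def exp_double)
      \<comment> \<open>The annulus has area at least \<open>6 * A\<close>, and
        \<open>7 / 16\<close> of that exceeds \<open>A\<close>.\<close>
      then have "3 * (2 * A) \<le> pi * ((exp (xs J))\<^sup>2 - (exp (xs 0))\<^sup>2)"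
        using A pi_gt3 by (intro mult_mono) auto
      then show "1 * A \<le> measure lborel (S.good J)"
        using S.measure_good_ge[OF J0] A by linarith
    next
      fix z assume z: "z \<in> S.good J"
      have "L \<le> c0 / 8 * exp (xs 0 - 35)" by (rule y)
      also have "\<dots> = c0 / 4 * exp (2 * xs 0) * exp (- 33) / 2 / exp (xs 0 + 2)"
      proof -
        have "exp (xs 0 - 35) = exp (2 * xs 0 + - 33 - (xs 0 + 2))" by simp
        also have "\<dots> = exp (2 * xs 0) * exp (- 33) / exp (xs 0 + 2)" by (simp only: exp_diff exp_add)
        finally show ?thesis by simp
      qed
      also have "\<dots> \<le> real (ns 0) * exp (- 33) / 2 / exp (xs J)"
        using X1(2)[OF y(2)] J2 by (intro frac_le divide_right_mono mult_right_mono) (auto simp: S.\<nu>_xs)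
      also have "\<dots> \<le> cmod (deriv (S.comb J) z) * exp (- W z)" by (rule S.norm_deriv_comb_ge[OF z])
      finally show "L \<le> cmod (deriv (S.comb J) z) * exp (- W z)" .
    next
      assume "p \<noteq> \<infinity>"
      then have "(\<integral>\<^sup>+z. ennreal ((cmod (S.comb J z) * exp (- W z)) powr enn2real p) \<partial>lborel)
         \<le> ennreal (3 powr P * pi * (1 + 4 * exp (P / 2)) * exp (2 * xs J))"
        using S.nn_integral_comb_le[OF J0 P y(1,4,5)] by (simp add: P_def)
      also have "\<dots> \<le> ennreal (K * A)"
      proof (rule ennreal_leI)
        have "exp (2 * xs J) \<le> exp (2 * (xs 0 + 2))" using J2 by simp
        also have "\<dots> = exp 4 * A" by (simp add: A_def exp_add[symmetric])
        finally have "3 powr P * pi * (1 + 4 * exp (P / 2)) * exp (2 * xs J) \<le> 3 powr P * pi * (1 + 4 * exp (P / 2)) * (exp 4 * A)"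
          by (intro mult_left_mono mult_nonneg_nonneg add_nonneg_nonneg) auto
        also have "\<dots> = K0 * A" by (simp add: K0_def)
        also have "\<dots> \<le> K * A" using A by (intro mult_right_mono) (auto simp: K_def)
        finally show "3 powr P * pi * (1 + 4 * exp (P / 2)) * exp (2 * xs J) \<le> K * A" .
      qed
      finally show "(\<integral>\<^sup>+z. ennreal ((cmod (S.comb J z) * exp (- W z)) powr enn2real p) \<partial>lborel) \<le> ennreal (K * A)" .
    qed (use hol A qp S.good_fmeasurable in \<open>auto simp: fmeasurable_def\<close>)
  qed (use p q W_measurable in \<open>auto simp: K_def\<close>)
qed

end

section \<open>The two weights\<close>

text \<open>A point on the positive axis represents its whole circle. Along the axis the extension
  is \<open>\<psi>\<close> itself; across it the distance to the origin is stationary, so only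
  \<open>\<psi>1 r / r\<close> survives.\<close>

lemma laplacian_radial_ext:
  assumes \<psi>1: "\<And>r. r > 0 \<Longrightarrow> (\<psi> has_real_derivative \<psi>1 r) (at r)"
    and \<psi>2: "\<And>r. r > 0 \<Longrightarrow> (\<psi>1 has_real_derivative \<psi>2 r) (at r)"
    and r: "r > 0"
  shows "laplacian (radial_ext \<psi>) (of_real r) = \<psi>2 r + \<psi>1 r / r"
proof -
  have horizontal: "deriv (deriv (\<lambda>x. radial_ext \<psi> (Complex x 0))) r = \<psi>2 r"
  proof -
    have "deriv (\<lambda>x. radial_ext \<psi> (Complex x 0)) x = \<psi>1 x" if x: "x > 0" for x
    proof (rule DERIV_imp_deriv)
      show "((\<lambda>x. radial_ext \<psi> (Complex x 0)) has_real_derivative \<psi>1 x) (at x)"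
        using \<psi>1[OF x]
        by (rule has_field_derivative_transform_within_open[of \<psi> _ _ "{0<..}"])
           (use x in \<open>auto simp: radial_ext_def cmod_def\<close>)
    qed
    then have "(deriv (\<lambda>x. radial_ext \<psi> (Complex x 0)) has_real_derivative \<psi>2 r) (at r)"
      by (intro has_field_derivative_transform_within_open[OF \<psi>2[OF r], of "{0<..}"]) (use r in auto)
    then show ?thesis by (rule DERIV_imp_deriv)
  qed
  define s where "s y = sqrt (r\<^sup>2 + y\<^sup>2)" for y
  have s: "s y > 0" for y using r by (simp add: s_def add_pos_nonneg)
  have Ds: "(s has_real_derivative y / s y) (at y)" for y
    unfolding s_def[abs_def] using s[of y]
    by (auto intro!: derivative_eq_intros simp: s_def field_simps)
  have vertical: "deriv (deriv (\<lambda>y. radial_ext \<psi> (Complex r y))) 0 = \<psi>1 r / r"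
  proof -
    have eq: "(\<lambda>y. radial_ext \<psi> (Complex r y)) = (\<lambda>y. \<psi> (s y))"
      by (simp add: radial_ext_def cmod_def s_def)
    have "deriv (\<lambda>y. \<psi> (s y)) y = \<psi>1 (s y) * (y / s y)" for y
      by (rule DERIV_imp_deriv) (rule DERIV_chain2[OF \<psi>1[OF s] Ds])
    then have "deriv (\<lambda>y. \<psi> (s y)) = (\<lambda>y. \<psi>1 (s y) * (y / s y))" by (rule ext)
    moreover have "((\<lambda>y. \<psi>1 (s y) * (y / s y)) has_real_derivative
        \<psi>2 (s 0) * (0 / s 0) * (0 / s 0) + ((1 * s 0 - 0 * (0 / s 0)) / (s 0 * s 0)) * \<psi>1 (s 0)) (at 0)"
      using s[of 0] by (intro DERIV_mult DERIV_chain2[OF \<psi>2[OF s] Ds] DERIV_divide DERIV_ident Ds) auto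
    moreover have "s 0 = r" using r by (simp add: s_def)
    ultimately show ?thesis using r by (simp add: eq DERIV_imp_deriv)
  qed
  show ?thesis using horizontal vertical by (simp add: laplacian_def)
qed

lemma classical_weight_log_convex:
  "log_convex_weight classical_weight (\<lambda>x. exp (2 * x) / 2) (\<lambda>x. exp (2 * x)) (\<lambda>x. 2 * exp (2 * x)) 1 0"
proof
  show "classical_weight \<in> borel_measurable borel"
    unfolding classical_weight_def[abs_def] by measurable
qed (auto intro!: derivative_eq_intros simp: classical_weight_def exp_double power2_eq_square)

lemma rapid_weight_log_convex:
  assumes "rapid_weight \<psi>"
  shows "\<exists>\<phi> \<nu> \<phi>2 c0 X0. log_convex_weight (radial_ext \<psi>) \<phi> \<nu> \<phi>2 c0 X0"
proof -
  obtain \<tau> where \<tau>: "rapid_weight_with \<psi> \<tau>" using assms by (auto simp: rapid_weight_def)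
  obtain \<psi>1 \<psi>2 where d1: "\<And>r. r \<ge> 0 \<Longrightarrow> (\<psi> has_real_derivative \<psi>1 r) (at r within {0..})"
    and d2: "\<And>r. r \<ge> 0 \<Longrightarrow> (\<psi>1 has_real_derivative \<psi>2 r) (at r within {0..})"
    using \<tau> by (auto simp: rapid_weight_with_def C2_halfline_def)
  have within: "at r within {0..} = at r" if "r > 0" for r :: real
    using that by (intro at_within_interior) (simp add: interior_real_atLeast)
  have D1: "(\<psi> has_real_derivative \<psi>1 r) (at r)" and D2: "(\<psi>1 has_real_derivative \<psi>2 r) (at r)"
    if "r > 0" for r
    using d1[of r] d2[of r] that within[OF that] by auto
  have lap: "laplacian (radial_ext \<psi>) (of_real r) = \<psi>2 r + \<psi>1 r / r" if "r > 0" for r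
    using laplacian_radial_ext[OF D1 D2 that] .
  have lap_pos: "\<psi>2 r + \<psi>1 r / r > 0" if "r > 0" for r
  proof -
    have "0 < laplacian (radial_ext \<psi>) (of_real r)"
      using \<tau> that unfolding rapid_weight_with_def by simp
    then show ?thesis using lap[OF that] by simp
  qed
  obtain C where C: "C > 0" and le: "\<And>z. 1 \<le> cmod z \<Longrightarrow>
      inverse C * laplacian (radial_ext \<psi>) z powr (- 1 / 2) \<le> radial_ext \<tau> z"
    using \<tau> by (auto simp: rapid_weight_with_def comparable_on_def)
  have "(\<tau> \<longlongrightarrow> 0) at_top" using \<tau> by (simp add: rapid_weight_with_def)
  then have "\<forall>\<^sub>F r in at_top. \<tau> r < inverse C" using C by (intro order_tendstoD) auto
  then obtain R where R: "\<And>r. r \<ge> R \<Longrightarrow> \<tau> r < inverse C" by (auto simp: eventually_at_top_linorder)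
  \<comment> \<open>A Laplacian below 1 would make \<open>\<tau>\<close> at least
    \<open>inverse C\<close> by comparability; beyond \<open>R\<close> it is smaller. This is why
    \<open>c0 = 1\<close> can be taken.\<close>
  have lap_ge: "1 \<le> \<psi>2 r + \<psi>1 r / r" if r: "r \<ge> max R 1" for r
  proof (rule ccontr)
    assume "\<not> ?thesis"
    then have "1 powr (- 1 / 2) \<le> (\<psi>2 r + \<psi>1 r / r) powr (- 1 / 2)"
      using lap_pos[of r] r by (intro powr_mono2') auto
    then have "inverse C * 1 \<le> inverse C * (\<psi>2 r + \<psi>1 r / r) powr (- 1 / 2)"
      using C by (intro mult_left_mono) auto
    also have "\<dots> \<le> \<tau> r" using le[of "of_real r"] lap[of r] r by (simp add: radial_ext_def)
    finally show False using R[of r] r by simp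
  qed
  \<comment> \<open>\<open>r ^ 2\<close> times the Laplacian is the derivative of
    \<open>r * \<psi>1 r\<close> with respect to \<open>ln r\<close>, written here as the product
    rule delivers it.\<close>
  have eq: "exp (2 * x) * (\<psi>2 (exp x) + \<psi>1 (exp x) / exp x) = \<psi>2 (exp x) * exp x * exp x + exp x * \<psi>1 (exp x)" for x
  proof -
    have "exp (2 * x) = exp x * exp x" by (simp add: exp_double power2_eq_square)
    then show ?thesis by (simp only:) (simp add: field_simps)
  qed
  have "log_convex_weight (radial_ext \<psi>) (\<lambda>x. \<psi> (exp x)) (\<lambda>x. \<psi>1 (exp x) * exp x)
     (\<lambda>x. exp (2 * x) * (\<psi>2 (exp x) + \<psi>1 (exp x) / exp x)) 1 (ln (max R 1))"
  proof
    have "continuous_on {0..} \<psi>"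
      using d1 by (auto simp: continuous_on_eq_continuous_within intro: DERIV_continuous)
    then have "continuous_on UNIV (radial_ext \<psi>)"
      unfolding radial_ext_def[abs_def]
      by (rule continuous_on_compose2) (auto intro!: continuous_intros)
    then show "radial_ext \<psi> \<in> borel_measurable borel" by (rule borel_measurable_continuous_onI)
    fix z :: complex and x :: real
    show "z \<noteq> 0 \<Longrightarrow> radial_ext \<psi> z = \<psi> (exp (ln (cmod z)))" by (simp add: radial_ext_def)
    show "((\<lambda>x. \<psi> (exp x)) has_real_derivative \<psi>1 (exp x) * exp x) (at x)"
      by (intro DERIV_chain2[OF D1] DERIV_exp) simp
    show "((\<lambda>x. \<psi>1 (exp x) * exp x) has_real_derivative
        exp (2 * x) * (\<psi>2 (exp x) + \<psi>1 (exp x) / exp x)) (at x)"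
      unfolding eq by (intro DERIV_mult DERIV_chain2[OF D2] DERIV_exp) simp
    show "0 < exp (2 * x) * (\<psi>2 (exp x) + \<psi>1 (exp x) / exp x)"
      by (intro mult_pos_pos lap_pos) auto
    show "1 * exp (2 * x) \<le> exp (2 * x) * (\<psi>2 (exp x) + \<psi>1 (exp x) / exp x)" if "ln (max R 1) \<le> x"
    proof -
      have "exp (ln (max R 1)) \<le> exp x" using that by (simp only: exp_le_cancel_iff)
      then have "max R 1 \<le> exp x" by (subst (asm) exp_ln) auto
      from lap_ge[OF this] show ?thesis by simp
    qed
  qed simp
  then show ?thesis by blast
qed

theorem theorem1p3:
  fixes p q :: ennreal and \<psi> :: "real \<Rightarrow> real"
  assumes "0 < p" and "0 < q"
  shows "(rapid_weight \<psi> \<longrightarrow> \<not> fock_bounded p q (radial_ext \<psi>) deriv) \<and>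
         \<not> fock_bounded p q classical_weight deriv"
proof -
  have unbounded: "\<not> fock_bounded p q W deriv" if "log_convex_weight W \<phi> \<nu> \<phi>2 c0 X0"
    for W \<phi> \<nu> \<phi>2 c0 X0
    using log_convex_weight.not_fock_bounded_le[OF that assms(1)]
      log_convex_weight.not_fock_bounded_ge[OF that assms(2)] linear[of p q] by blast
  show ?thesis
    using unbounded rapid_weight_log_convex classical_weight_log_convex by blast
qed

end
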